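(* Let $\{G_n\}_{n=1}^{\infty}$ be a sequence of uniformly nonamenable, transitive, infinite, connected, locally finite graphs converging locally to a transitive, infinite, connected, locally finite graph $G$. Suppose that $G$ satisfies the following two rough uniformity conditions, where $u$ is a vertex of $G$ (by transitivity the conditions do not depend on the choice of $u$): (i) there exist constants $0<c,C<\infty$ such that $$c\le \frac{\mu_n(x)}{\mu_n(y)}\le C\qquad\text{for all } n\in\mathbb{N}\text{ and all } x,y\in\partial B_G(u,n);$$ (ii) for every $p\in(p_c(G),1)$ there are positive constants $c_1(p),c_2(p)$, depending on $p$, such that $$c_1(p)\le \frac{b_n(x,u)}{b_n(y,u)}\le c_2(p)\qquad\text{for all } n\in\mathbb{N}\text{ and all } x,y\in\partial B_G(u,n).$$ Then $p_c(G_n)\to p_c(G)$ as $n\to\infty$.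
   Context: Here $\mathbb{N}=\{1,2,\dots\}$ and $\mathbb{Z}_+$ is the set of nonnegative integers. A graph is transitive if its automorphism group acts transitively on its vertices. For a locally finite infinite connected graph $G$, $\mathbb{P}_{G,p}$ denotes the product law of Bernoulli bond percolation on $G$ in which each edge is open with probability $p$, and $p_c(G)=\inf\{p\in[0,1]:\mathbb{P}_{G,p}(\exists\text{ an infinite open component})>0\}$. $B_G(v,R)$ is the ball of radius $R\in\mathbb{Z}_+$ centered at the vertex $v$ in the graph distance of $G$ (regarded also as the induced subgraph rooted at $v$), and $\partial B_G(v,n)=B_G(v,n)\setminus B_G(v,n-1)$ for $n\in\mathbb{N}$. A sequence $\{G_n\}$ of transitive graphs converges locally to a transitive graph $G$ if for every $R\in\mathbb{Z}_+$ there is $N\in\mathbb{N}$ such that for all $n\ge N$ the balls $B_{G_n}(v_n,R)$ and $B_G(v,R)$ are isomorphic as rooted graphs, where $v_n$ and $v$ are arbitrary vertices of $G_n$ and $G$. For a connected graph $H$ of bounded degree, let $P$ be the transition matrix of simple random walk on $H$. Then $\lambda_1(H)$, the bottom of the spectrum of $I-P$, is the largest constant $\lambda_1$ such that $\langle f,(I-P)f\rangle\ge\lambda_1\langle f,f\rangle$ for all $f\in\ell^2(H,\deg(\cdot))$, with the inner product of $\ell^2(H,\deg(\cdot))$. An infinite bounded degree connected graph $H$ is nonamenable if and only if $\lambda_1(H)>0$; the sequence $\{G_n\}$ is uniformly nonamenable if $\inf_{n\ge1}\lambda_1(G_n)>0$. For $u\in V(G)$, $n\in\mathbb{N}$ and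 $x\in\partial B_G(u,n)$: let $\{X_t\}_{t\ge0}$ be simple random walk on $G$, let $\sigma_n=\inf\{t: X_t\notin B_G(X_0,n-1)\}$, and set $\mu_n(x)=\mathbb{P}[X_{\sigma_n}=x\mid X_0=u]$. For $p\in(p_c(G),1)$, set $b_n(x,u)=\mathbb{P}_{G,p}[x\text{ is connected to }u\text{ by an open path in }B_G(u,n)]$ (this depends on $p$). *)

theory Defs
  imports "HOL-Probability.Probability"
begin

section \<open>Simple graphs\<close>

record 'a ugraph =
  verts :: "'a set"
  edges :: "'a set set"

definition simple_graph :: "'a ugraph \<Rightarrow> bool" where
  "simple_graph G \<longleftrightarrow>
     (\<forall>e\<in>edges G. \<exists>x\<in>verts G. \<exists>y\<in>verts G. x \<noteq> y \<and> e = {x, y})"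

definition adj :: "'a ugraph \<Rightarrow> ('a \<times> 'a) set" where
  "adj G = {(x, y). {x, y} \<in> edges G}"

definition nbrs :: "'a ugraph \<Rightarrow> 'a \<Rightarrow> 'a set" where
  "nbrs G x = {y. (x, y) \<in> adj G}"

definition deg :: "'a ugraph \<Rightarrow> 'a \<Rightarrow> nat" where
  "deg G x = card (nbrs G x)"

definition locally_finite_graph :: "'a ugraph \<Rightarrow> bool" where
  "locally_finite_graph G \<longleftrightarrow> (\<forall>x\<in>verts G. finite (nbrs G x))"

definition connected_graph :: "'a ugraph \<Rightarrow> bool" where
  "connected_graph G \<longleftrightarrow>
     verts G \<noteq> {} \<and> (\<forall>x\<in>verts G. \<forall>y\<in>verts G. (x, y) \<in> (adj G)\<^sup>*)"

definition graph_iso :: "('a \<Rightarrow> 'b) \<Rightarrow> 'a ugraph \<Rightarrow> 'b ugraph \<Rightarrow> bool" where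
  "graph_iso f G H \<longleftrightarrow> bij_betw f (verts G) (verts H) \<and>
     (\<forall>x\<in>verts G. \<forall>y\<in>verts G. (x, y) \<in> adj G \<longleftrightarrow> (f x, f y) \<in> adj H)"

definition transitive_graph :: "'a ugraph \<Rightarrow> bool" where
  "transitive_graph G \<longleftrightarrow>
     (\<forall>x\<in>verts G. \<forall>y\<in>verts G. \<exists>f. graph_iso f G G \<and> f x = y)"

definition rooted_isomorphic :: "'a ugraph \<Rightarrow> 'a \<Rightarrow> 'b ugraph \<Rightarrow> 'b \<Rightarrow> bool" where
  "rooted_isomorphic G r H s \<longleftrightarrow> (\<exists>f. graph_iso f G H \<and> f r = s)"

definition induced :: "'a ugraph \<Rightarrow> 'a set \<Rightarrow> 'a ugraph" where
  "induced G W = \<lparr>verts = verts G \<inter> W, edges = {e \<in> edges G. e \<subseteq> W}\<rparr>"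

text \<open>The distance is \<open>\<infinity>\<close> between vertices that no path joins.\<close>

definition gdist :: "'a ugraph \<Rightarrow> 'a \<Rightarrow> 'a \<Rightarrow> enat" where
  "gdist G x y = (INF k\<in>{k. (x, y) \<in> adj G ^^ k}. enat k)"

definition gball :: "'a ugraph \<Rightarrow> 'a \<Rightarrow> nat \<Rightarrow> 'a set" where
  "gball G v R = {x \<in> verts G. gdist G v x \<le> enat R}"

text \<open>The sphere is only meant for radii \<open>n \<ge> 1\<close>.\<close>

definition gsphere :: "'a ugraph \<Rightarrow> 'a \<Rightarrow> nat \<Rightarrow> 'a set" where
  "gsphere G v n = gball G v n - gball G v (n - 1)"

definition converges_locally :: "(nat \<Rightarrow> 'a ugraph) \<Rightarrow> 'b ugraph \<Rightarrow> bool" where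
  "converges_locally Gs G \<longleftrightarrow>
     (\<forall>R. \<exists>N\<ge>1. \<forall>n\<ge>N. \<forall>v\<in>verts (Gs n). \<forall>w\<in>verts G.
        rooted_isomorphic (induced (Gs n) (gball (Gs n) v R)) v (induced G (gball G w R)) w)"

section \<open>Bernoulli bond percolation\<close>

definition percolation :: "'a ugraph \<Rightarrow> real \<Rightarrow> ('a set \<Rightarrow> bool) measure" where
  "percolation G p = PiM (edges G) (\<lambda>_. measure_pmf (bernoulli_pmf p))"

definition open_subgraph :: "'a ugraph \<Rightarrow> ('a set \<Rightarrow> bool) \<Rightarrow> 'a ugraph" where
  "open_subgraph G \<omega> = \<lparr>verts = verts G, edges = {e \<in> edges G. \<omega> e}\<rparr>"

definition component :: "'a ugraph \<Rightarrow> 'a \<Rightarrow> 'a set" where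
  "component H v = {x \<in> verts H. (v, x) \<in> (adj H)\<^sup>*}"

definition p_c :: "'a ugraph \<Rightarrow> real" where
  "p_c G = Inf {p \<in> {0..1}.
     measure (percolation G p)
       {\<omega> \<in> space (percolation G p).
          \<exists>v\<in>verts G. infinite (component (open_subgraph G \<omega>) v)} > 0}"

definition conn_in_ball :: "'a ugraph \<Rightarrow> real \<Rightarrow> 'a \<Rightarrow> nat \<Rightarrow> 'a \<Rightarrow> real" where
  "conn_in_ball G p u n x = measure (percolation G p)
     {\<omega> \<in> space (percolation G p).
        (x, u) \<in> (adj (induced (open_subgraph G \<omega>) (gball G u n)))\<^sup>*}"

section \<open>Simple random walk\<close>

text \<open>The law of the trajectory \<open>(X\<^sub>0, X\<^sub>1, \<dots>)\<close> is the Ionescu-Tulcea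
  measure of the kernels below; the \<open>n\<close>-th kernel gives the conditional law of
  \<open>X\<^sub>n\<close> given \<open>X\<^sub>0, \<dots>, X\<^bsub>n-1\<^esub>\<close>.\<close>

definition srw_kernel :: "'a ugraph \<Rightarrow> 'a \<Rightarrow> nat \<Rightarrow> (nat \<Rightarrow> 'a) \<Rightarrow> 'a measure" where
  "srw_kernel G u n X = measure_pmf
     (case n of 0 \<Rightarrow> return_pmf u | Suc m \<Rightarrow> pmf_of_set (nbrs G (X m)))"

lemma Ionescu_Tulcea_srw: "Ionescu_Tulcea (srw_kernel G u) (\<lambda>_. count_space UNIV)"
proof (rule Ionescu_Tulcea.intro)
  fix i
  show "srw_kernel G u i \<in> PiM {0..<i} (\<lambda>_. count_space UNIV) \<rightarrow>\<^sub>M subprob_algebra (count_space UNIV)"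
  proof (cases i)
    case 0
    then show ?thesis
      by (simp add: srw_kernel_def[abs_def] measure_pmf_in_subprob_algebra)
  next
    case (Suc m)
    have "(\<lambda>y. measure_pmf (pmf_of_set (nbrs G y)))
            \<in> count_space UNIV \<rightarrow>\<^sub>M subprob_algebra (count_space UNIV)"
      by (simp add: measure_pmf_in_subprob_algebra)
    moreover have "(\<lambda>X. X m) \<in> PiM {0..<i} (\<lambda>_. count_space UNIV) \<rightarrow>\<^sub>M count_space UNIV"
      by (rule measurable_component_singleton) (simp add: Suc)
    ultimately show ?thesis
      using measurable_compose by (fastforce simp add: srw_kernel_def[abs_def] Suc)
  qed
  show "prob_space (srw_kernel G u i X)" for X
    by (simp add: srw_kernel_def prob_space_measure_pmf)
qed

definition srw :: "'a ugraph \<Rightarrow> 'a \<Rightarrow> (nat \<Rightarrow> 'a) measure" where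
  "srw G u = projective_family.lim UNIV
     (Ionescu_Tulcea.CI (srw_kernel G u) (\<lambda>_. count_space UNIV)) (\<lambda>_. count_space UNIV)"

lemma prob_space_srw: "prob_space (srw G u)"
proof -
  interpret Ionescu_Tulcea "srw_kernel G u" "\<lambda>_. count_space UNIV"
    by (rule Ionescu_Tulcea_srw)
  have "emeasure PF.lim (PF.emb UNIV {} (space (PiM {} (\<lambda>_. count_space UNIV)))) =
      emeasure (CI {}) (space (PiM {} (\<lambda>_. count_space UNIV)))"
    by (rule lim) auto
  also have "\<dots> = 1"
    using prob_space.emeasure_space_1[OF PF.prob_space_P[of "{}"]] by (simp add: PF.space_P)
  finally have "emeasure PF.lim
      (PF.emb UNIV {} (space (PiM {} (\<lambda>_. count_space UNIV)))) = 1" .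
  moreover have "PF.emb UNIV {} (space (PiM {} (\<lambda>_. count_space UNIV))) = space PF.lim"
    by (auto simp: prod_emb_def space_PiM)
  ultimately show ?thesis
    unfolding srw_def by (intro prob_spaceI) simp
qed

text \<open>The cylinder probabilities characterize this law as simple random walk started at \<open>u\<close>.\<close>

lemma emeasure_srw_cylinder:
  fixes G :: "'a ugraph" and w :: "nat \<Rightarrow> 'a"
  shows "emeasure (srw G u) {X. \<forall>i\<le>n. X i = w i} =
     indicator {u} (w 0) * (\<Prod>i<n. ennreal (pmf (pmf_of_set (nbrs G (w i))) (w (Suc i))))"
proof -
  interpret Ionescu_Tulcea "srw_kernel G u" "\<lambda>_. count_space UNIV"
    by (rule Ionescu_Tulcea_srw)
  let ?M = "\<lambda>_ :: nat. count_space UNIV :: 'a measure"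
  have meas: "{restrict w {0..<k}} \<in> sets (PiM {0..<k} ?M)" for k
  proof -
    have "{restrict w {0..<k}} = (\<Pi>\<^sub>E i\<in>{0..<k}. {w i})"
      by (auto simp: PiE_iff extensional_def fun_eq_iff restrict_def)
    then show ?thesis by (simp add: sets_PiM_I_finite)
  qed
  have step: "emeasure (C 0 (Suc k) (\<lambda>_. undefined)) {restrict w {0..<Suc k}} =
      emeasure (C 0 k (\<lambda>_. undefined)) {restrict w {0..<k}} *
      emeasure (srw_kernel G u k w) {w k}" for k
  proof -
    have undef: "(\<lambda>_. undefined) \<in> space (PiM {0..<0} ?M)" by (simp add: space_PiM)
    have sp: "space (C 0 k (\<lambda>_. undefined)) = space (PiM {0..<k} ?M)"
      using space_C[OF undef, of k] by simp
    have eq: "emeasure (eP k X) {restrict w {0..<Suc k}} =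
        emeasure (srw_kernel G u k w) {w k} * indicator {restrict w {0..<k}} X"
      if X: "X \<in> space (PiM {0..<k} ?M)" for X
    proof -
      have "(\<lambda>x. X(k := x)) -` {restrict w {0..<Suc k}} =
          (if X = restrict w {0..<k} then {w k} else {})"
        using X by (auto simp: space_PiM PiE_def extensional_def fun_eq_iff restrict_def
            less_Suc_eq split: if_splits) (metis less_irrefl)+
      moreover have "srw_kernel G u k (restrict w {0..<k}) = srw_kernel G u k w"
        by (cases k) (auto simp: srw_kernel_def)
      ultimately show ?thesis
        using X meas[of "Suc k"] by (subst emeasure_eP) (auto simp: indicator_def)
    qed
    have "emeasure (C 0 (Suc k) (\<lambda>_. undefined)) {restrict w {0..<Suc k}} =
        (\<integral>\<^sup>+X. emeasure (eP k X) {restrict w {0..<Suc k}} \<partial>C 0 k (\<lambda>_. undefined))"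
      using meas[of "Suc k"] measurable_eP[of k] sets_C[OF undef, of k] sp
      by (simp, subst emeasure_bind[where N="PiM {0..<Suc k} ?M"])
         (auto cong: measurable_cong_sets simp: space_PiM PiE_eq_empty_iff)
    also have "\<dots> = (\<integral>\<^sup>+X. emeasure (srw_kernel G u k w) {w k} *
        indicator {restrict w {0..<k}} X \<partial>C 0 k (\<lambda>_. undefined))"
      using sp eq by (intro nn_integral_cong) auto
    also have "\<dots> = emeasure (srw_kernel G u k w) {w k} *
        emeasure (C 0 k (\<lambda>_. undefined)) {restrict w {0..<k}}"
      using meas[of k] sets_C[OF undef, of k] by (subst nn_integral_cmult_indicator) auto
    finally show ?thesis by (simp add: mult.commute)
  qed
  have C0: "emeasure (C 0 0 (\<lambda>_. undefined)) {restrict w {0..<0}} = 1"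
    using meas[of 0] by (simp add: restrict_def)
  have prod: "emeasure (C 0 (Suc k) (\<lambda>_. undefined)) {restrict w {0..<Suc k}} =
      indicator {u} (w 0) * (\<Prod>i<k. ennreal (pmf (pmf_of_set (nbrs G (w i))) (w (Suc i))))" for k
  proof (induction k)
    case 0
    show ?case
      using C0 unfolding step[of 0]
      by (auto simp: srw_kernel_def emeasure_pmf_single indicator_def)
  next
    case (Suc k)
    show ?case
      unfolding step[of "Suc k"] Suc.IH
      by (simp add: srw_kernel_def emeasure_pmf_single mult.assoc)
  qed
  have "{X. \<forall>i\<le>n. X i = w i} = PF.emb UNIV {0..<Suc n} {restrict w {0..<Suc n}}"
    by (auto simp: prod_emb_def space_PiM fun_eq_iff restrict_def less_Suc_eq_le) metis
  then have "emeasure (srw G u) {X. \<forall>i\<le>n. X i = w i} =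
      emeasure (CI {0..<Suc n}) {restrict w {0..<Suc n}}"
    unfolding srw_def using lim[of "{0..<Suc n}", OF _ meas] by simp
  also have "\<dots> = emeasure (C 0 (Suc n) (\<lambda>_. undefined)) {restrict w {0..<Suc n}}"
  proof -
    have "PF.emb {0..<Suc n} {0..<Suc n} {restrict w {0..<Suc n}} = {restrict w {0..<Suc n}}"
      by (rule prod_emb_id) (auto simp: space_PiM)
    then show ?thesis
      using emeasure_CI[OF subset_refl meas[of "Suc n"]] by (simp del: C.simps)
  qed
  also note prod[of n]
  finally show ?thesis .
qed

definition exit_time :: "'a ugraph \<Rightarrow> nat \<Rightarrow> (nat \<Rightarrow> 'a) \<Rightarrow> enat" where
  "exit_time G n X = (INF t\<in>{t. X t \<notin> gball G (X 0) (n - 1)}. enat t)"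

definition exit_prob :: "'a ugraph \<Rightarrow> 'a \<Rightarrow> nat \<Rightarrow> 'a \<Rightarrow> real" where
  "exit_prob G u n x = measure (srw G u)
     {X \<in> space (srw G u). \<exists>t. exit_time G n X = enat t \<and> X t = x}"

section \<open>Bottom of the spectrum and nonamenability\<close>

text \<open>Functions on the vertices are modelled by functions on the whole type, whose values off
  \<open>verts G\<close> are never used.\<close>

definition transition_op :: "'a ugraph \<Rightarrow> ('a \<Rightarrow> real) \<Rightarrow> 'a \<Rightarrow> real" where
  "transition_op G f x = (\<Sum>y\<in>nbrs G x. f y / real (deg G x))"

definition l2_deg :: "'a ugraph \<Rightarrow> ('a \<Rightarrow> real) set" where
  "l2_deg G = {f. (\<lambda>x. real (deg G x) * (f x)\<^sup>2) summable_on verts G}"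

definition inner_deg :: "'a ugraph \<Rightarrow> ('a \<Rightarrow> real) \<Rightarrow> ('a \<Rightarrow> real) \<Rightarrow> real" where
  "inner_deg G f g = (\<Sum>\<^sub>\<infinity>x\<in>verts G. real (deg G x) * f x * g x)"

definition lambda1 :: "'a ugraph \<Rightarrow> real" where
  "lambda1 G = (GREATEST l. \<forall>f\<in>l2_deg G.
     inner_deg G f (\<lambda>x. f x - transition_op G f x) \<ge> l * inner_deg G f f)"

text \<open>The infimum is over a set of nonnegative reals, since the transition operator is a
  contraction of \<open>l2_deg\<close>.\<close>

definition uniformly_nonamenable :: "(nat \<Rightarrow> 'a ugraph) \<Rightarrow> bool" where
  "uniformly_nonamenable Gs \<longleftrightarrow> (INF n\<in>{1..}. lambda1 (Gs n)) > 0"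

end

theory Submission
  imports Defs
begin

text \<open>
  Write \<open>\<theta>\<^sub>N(p)\<close> for the probability that the open cluster of a vertex has at least \<open>N\<close> vertices.
  This event is decided inside the ball of radius \<open>N\<close>, so for fixed \<open>N\<close> the graphs \<open>Gs n\<close> and \<open>G\<close>
  have the same \<open>\<theta>\<^sub>N\<close> once \<open>n\<close> is large, and percolation at \<open>p\<close> means that \<open>\<theta>\<^sub>N(p)\<close> stays bounded
  away from \<open>0\<close> as \<open>N\<close> grows. Each half of the convergence is therefore a statement, uniform over the
  sequence, that relates \<open>\<theta>\<^sub>N\<close> at a finite scale to percolation.

  \<^emph>\<open>Lower semicontinuity.\<close> If a transitive graph percolates at \<open>p\<close> and \<open>q > p\<close>, then
  \<open>\<theta>\<^sub>N(q) \<ge> (q - p) / (1 + (q - p))\<close> for all \<open>N\<close> (\<open>percolating_mean_field\<close>, the argument of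
  Duminil-Copin and Tassion). This bound does not depend on the graph, so it passes to the local limit.

  \<^emph>\<open>Upper semicontinuity.\<close> Here uniform nonamenability gives a finite-size criterion: if \<open>\<theta>\<^sub>N(p)\<close> exceeds
  a constant at one scale \<open>N\<close> that is large in terms of that constant, the degree, the spectral gap and
  \<open>q - p\<close>, then the graph percolates at \<open>q\<close> (\<open>tail_all_scales\<close>). Reveal a cluster \<open>K\<close>, and let
  \<open>z \<notin> K\<close> lie within distance \<open>r\<close> of \<open>K\<close>. In a fresh configuration \<open>z\<close> has a cluster of size at least
  \<open>N\<close> with probability \<open>\<theta>\<^sub>N\<close>. Then either the cluster of \<open>z\<close> off \<open>K\<close> is already that large, or \<open>z\<close> is
  joined to \<open>K\<close>. In both cases opening one more boundary edge of \<open>K\<close> would enlarge \<open>K\<close>: in the second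
  case by \<open>z\<close> itself; in the first case by up to \<open>N\<close> vertices, which outweighs the exponential in \<open>r\<close>
  number of vertices \<open>z\<close> served by one edge and the cost of opening a path of length \<open>r\<close>, provided that \<open>r\<close>
  is a small multiple of \<open>log N\<close>. By expansion there are at least \<open>((1 + \<lambda>)\<^sup>r - 1) |K|\<close>
  such vertices, and this factor is a power of \<open>N\<close>. Hence the expectation of \<open>|K|\<close>, truncated at order
  \<open>N\<close>, has \<open>p\<close>-derivative at least a power of \<open>N\<close> times the contribution to it of the clusters of size
  of order \<open>N\<close>. As the truncated expectation is itself at most of order \<open>N\<close>, such clusters are
  polynomially rare at some parameter in any short interval. So
  \<open>\<theta>\<close> loses only a summable amount from one geometric scale to the next while \<open>p\<close> grows to \<open>q\<close>
  through a summable sequence of increments.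

  All estimates concern finitely many edges, so expectations are finite sums; the infinite product measure
  enters only to identify \<open>p_c\<close> (\<open>p_c_tail\<close>).
\<close>

section \<open>Expectations over finitely many independent edges\<close>

text \<open>
  The expectation of \<open>f\<close> at the random set of open edges, when each edge of \<open>E\<close> is open with probability \<open>p\<close>
  independently of the others. As a finite sum it is a polynomial in \<open>p\<close>, defined for all real \<open>p\<close>.
\<close>

definition bexp :: "'e set \<Rightarrow> real \<Rightarrow> ('e set \<Rightarrow> real) \<Rightarrow> real" where
  "bexp E p f = (\<Sum>\<omega>\<in>Pow E. p ^ card \<omega> * (1 - p) ^ card (E - \<omega>) * f \<omega>)"

lemma bexp_empty [simp]: "bexp {} p f = f {}"
  by (simp add: bexp_def)

lemma bexp_cong:
  assumes "\<And>\<omega>. \<omega> \<subseteq> E \<Longrightarrow> f \<omega> = g \<omega>"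
  shows "bexp E p f = bexp E p g"
  unfolding bexp_def using assms by (intro sum.cong) auto

lemma bexp_mono:
  assumes "0 \<le> p" "p \<le> 1" "\<And>\<omega>. \<omega> \<subseteq> E \<Longrightarrow> f \<omega> \<le> g \<omega>"
  shows "bexp E p f \<le> bexp E p g"
  unfolding bexp_def using assms by (intro sum_mono mult_left_mono) auto

lemma bexp_insert:
  assumes "finite E" "e \<notin> E"
  shows "bexp (insert e E) p f =
    p * bexp E p (\<lambda>\<omega>. f (insert e \<omega>)) + (1 - p) * bexp E p f"
proof -
  let ?w = "\<lambda>E \<omega>. p ^ card \<omega> * (1 - p) ^ card (E - \<omega>) * f \<omega>"
  have inj: "inj_on (insert e) (Pow E)"
    using assms(2) by (auto simp: inj_on_def)
  have "bexp (insert e E) p f = (\<Sum>\<omega>\<in>insert e ` Pow E. ?w (insert e E) \<omega>) + (\<Sum>\<omega>\<in>Pow E. ?w (insert e E) \<omega>)"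
    unfolding bexp_def Pow_insert using assms
    by (subst sum.union_disjoint) (auto simp: add.commute)
  also have "(\<Sum>\<omega>\<in>insert e ` Pow E. ?w (insert e E) \<omega>) = p * bexp E p (\<lambda>\<omega>. f (insert e \<omega>))"
    unfolding bexp_def sum.reindex[OF inj] sum_distrib_left
  proof (intro sum.cong refl)
    fix \<omega> assume "\<omega> \<in> Pow E"
    then have "finite \<omega>" "e \<notin> \<omega>" "insert e E - insert e \<omega> = E - \<omega>"
      using assms finite_subset by auto
    then show "(?w (insert e E) \<circ> insert e) \<omega> = p * (p ^ card \<omega> * (1 - p) ^ card (E - \<omega>) * f (insert e \<omega>))"
      by simp
  qed
  also have "(\<Sum>\<omega>\<in>Pow E. ?w (insert e E) \<omega>) = (1 - p) * bexp E p f"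
    unfolding bexp_def sum_distrib_left
  proof (intro sum.cong refl)
    fix \<omega> assume "\<omega> \<in> Pow E"
    then have "insert e E - \<omega> = insert e (E - \<omega>)" "e \<notin> E - \<omega>" "finite (E - \<omega>)"
      using assms by auto
    then show "?w (insert e E) \<omega> = (1 - p) * ?w E \<omega>"
      by simp
  qed
  finally show ?thesis .
qed

lemma bexp_remove:
  assumes "finite E" "e \<in> E"
  shows "bexp E p f =
    p * bexp (E - {e}) p (\<lambda>\<omega>. f (insert e \<omega>)) + (1 - p) * bexp (E - {e}) p f"
  using bexp_insert[of "E - {e}" e p f] assms by (simp add: insert_absorb)

lemma bexp_const [simp]: "finite E \<Longrightarrow> bexp E p (\<lambda>_. c) = c"
  by (induction E rule: finite_induct) (auto simp: bexp_insert algebra_simps)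

lemma bexp_add: "bexp E p (\<lambda>\<omega>. f \<omega> + g \<omega>) = bexp E p f + bexp E p g"
  by (simp add: bexp_def sum.distrib distrib_left)

lemma bexp_diff: "bexp E p (\<lambda>\<omega>. f \<omega> - g \<omega>) = bexp E p f - bexp E p g"
  by (simp add: bexp_def sum_subtractf right_diff_distrib)

lemma bexp_cmult: "bexp E p (\<lambda>\<omega>. c * f \<omega>) = c * bexp E p f"
  by (simp add: bexp_def sum_distrib_left mult_ac)

lemma bexp_sum: "bexp E p (\<lambda>\<omega>. \<Sum>i\<in>I. f i \<omega>) = (\<Sum>i\<in>I. bexp E p (f i))"
  unfolding bexp_def sum_distrib_left by (rule sum.swap)

lemma bexp_nonneg:
  assumes "0 \<le> p" "p \<le> 1" "\<And>\<omega>. \<omega> \<subseteq> E \<Longrightarrow> 0 \<le> f \<omega>"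
  shows "0 \<le> bexp E p f"
  unfolding bexp_def using assms by (intro sum_nonneg) auto

lemma bexp_le_const:
  assumes "finite E" "0 \<le> p" "p \<le> 1" "\<And>\<omega>. \<omega> \<subseteq> E \<Longrightarrow> f \<omega> \<le> c"
  shows "bexp E p f \<le> c"
  using bexp_mono[of p E f "\<lambda>_. c"] assms by simp

lemma bexp_Un:
  assumes "finite E" "finite F" "E \<inter> F = {}"
  shows "bexp (E \<union> F) p f = bexp E p (\<lambda>\<omega>. bexp F p (\<lambda>\<eta>. f (\<omega> \<union> \<eta>)))"
  using assms
proof (induction E arbitrary: f rule: finite_induct)
  case (insert e E)
  then show ?case
    by (simp add: bexp_insert)
qed simp

lemma bexp_marginal:
  assumes "finite E" "F \<subseteq> E"
  shows "bexp E p (\<lambda>\<omega>. f (\<omega> \<inter> F)) = bexp F p f"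
proof -
  have fin: "finite F" "finite (E - F)"
    using assms finite_subset by auto
  have "bexp (F \<union> (E - F)) p (\<lambda>\<omega>. f (\<omega> \<inter> F)) =
      bexp F p (\<lambda>\<omega>. bexp (E - F) p (\<lambda>\<eta>. f ((\<omega> \<union> \<eta>) \<inter> F)))"
    using fin by (intro bexp_Un) auto
  also have "\<dots> = bexp F p (\<lambda>\<omega>. bexp (E - F) p (\<lambda>\<eta>. f \<omega>))"
  proof (intro bexp_cong)
    fix \<omega> \<eta> assume "\<omega> \<subseteq> F" "\<eta> \<subseteq> E - F"
    then have "(\<omega> \<union> \<eta>) \<inter> F = \<omega>"
      by blast
    then show "f ((\<omega> \<union> \<eta>) \<inter> F) = f \<omega>"
      by simp
  qed
  also have "\<dots> = bexp F p f"
    using fin by simp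
  finally show ?thesis
    using assms(2) by (simp add: Un_absorb1)
qed

lemma bexp_image:
  assumes "finite E" "inj_on \<phi> E"
  shows "bexp (\<phi> ` E) p f = bexp E p (\<lambda>\<omega>. f (\<phi> ` \<omega>))"
  using assms
proof (induction E arbitrary: f rule: finite_induct)
  case (insert e E)
  then show ?case
    by (simp add: bexp_insert)
qed simp

text \<open>
  Russo's formula: by induction on the edges, since \<open>bexp\<close> is affine in the parameter of each edge.
\<close>

lemma bexp_has_derivative:
  assumes "finite E"
  shows "((\<lambda>p. bexp E p f) has_real_derivative
    (\<Sum>e\<in>E. bexp (E - {e}) p (\<lambda>\<omega>. f (insert e \<omega>) - f \<omega>))) (at p)"
  using assms
proof (induction E arbitrary: f rule: finite_induct)
  case empty
  show ?case by simp
next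
  case (insert a E)
  have eq: "(\<lambda>p. bexp (insert a E) p f) =
      (\<lambda>p. p * bexp E p (\<lambda>\<omega>. f (insert a \<omega>)) + (1 - p) * bexp E p f)"
    using insert.hyps by (simp add: bexp_insert)
  have split: "bexp (insert a E - {e}) p (\<lambda>\<omega>. f (insert e \<omega>) - f \<omega>) =
      p * bexp (E - {e}) p (\<lambda>\<omega>. f (insert a (insert e \<omega>)) - f (insert a \<omega>)) +
      (1 - p) * bexp (E - {e}) p (\<lambda>\<omega>. f (insert e \<omega>) - f \<omega>)" if "e \<in> E" for e
  proof -
    have "insert a E - {e} = insert a (E - {e})"
      using that insert.hyps by auto
    then show ?thesis
      using insert.hyps by (simp add: bexp_insert insert_commute)
  qed
  have a: "insert a E - {a} = E"
    using insert.hyps by auto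
  have "(\<Sum>e\<in>insert a E. bexp (insert a E - {e}) p (\<lambda>\<omega>. f (insert e \<omega>) - f \<omega>)) =
      bexp E p (\<lambda>\<omega>. f (insert a \<omega>)) - bexp E p f +
      (p * (\<Sum>e\<in>E. bexp (E - {e}) p (\<lambda>\<omega>. f (insert a (insert e \<omega>)) - f (insert a \<omega>))) +
      (1 - p) * (\<Sum>e\<in>E. bexp (E - {e}) p (\<lambda>\<omega>. f (insert e \<omega>) - f \<omega>)))"
    using insert.hyps
    by (simp add: a split sum.distrib sum_distrib_left bexp_diff[of _ _ "\<lambda>\<omega>. f (insert a \<omega>)" f])
  then show ?case
    unfolding eq
    by (auto intro!: derivative_eq_intros insert.IH simp: algebra_simps)
qed

text \<open>
  In Russo's formula the state of \<open>e\<close> itself is not averaged over. Averaging over it multiplies the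
  contribution of \<open>e\<close> by the probability \<open>1 - p\<close> that \<open>e\<close> is closed, because \<open>insert e \<omega> = \<omega>\<close> when \<open>e\<close>
  is open. This form is the one to which exploration of a cluster in \<open>\<omega>\<close> applies.
\<close>

lemma bexp_derivative_ge:
  assumes "finite E" "0 \<le> p" "p \<le> 1"
    and mono: "\<And>\<omega> e. \<omega> \<subseteq> E \<Longrightarrow> e \<in> E \<Longrightarrow> f \<omega> \<le> f (insert e \<omega>)"
  shows "bexp E p (\<lambda>\<omega>. \<Sum>e\<in>E. f (insert e \<omega>) - f \<omega>) \<le>
    (\<Sum>e\<in>E. bexp (E - {e}) p (\<lambda>\<omega>. f (insert e \<omega>) - f \<omega>))"
  unfolding bexp_sum
proof (rule sum_mono)
  fix e assume e: "e \<in> E"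
  have "0 \<le> bexp (E - {e}) p (\<lambda>\<omega>. f (insert e \<omega>) - f \<omega>)"
    using assms e by (intro bexp_nonneg) (auto simp: subset_iff)
  then have "(1 - p) * bexp (E - {e}) p (\<lambda>\<omega>. f (insert e \<omega>) - f \<omega>) \<le>
      1 * bexp (E - {e}) p (\<lambda>\<omega>. f (insert e \<omega>) - f \<omega>)"
    using assms by (intro mult_right_mono) auto
  then show "bexp E p (\<lambda>\<omega>. f (insert e \<omega>) - f \<omega>) \<le> bexp (E - {e}) p (\<lambda>\<omega>. f (insert e \<omega>) - f \<omega>)"
    using assms(1) e by (simp add: bexp_remove)
qed

lemma bexp_mono_prob:
  assumes "finite E" "0 \<le> p" "p \<le> q" "q \<le> 1"
    and mono: "\<And>\<omega> e. \<omega> \<subseteq> E \<Longrightarrow> e \<in> E \<Longrightarrow> f \<omega> \<le> f (insert e \<omega>)"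
  shows "bexp E p f \<le> bexp E q f"
proof (rule DERIV_nonneg_imp_nondecreasing[OF assms(3)])
  fix x assume x: "p \<le> x" "x \<le> q"
  have "0 \<le> (\<Sum>e\<in>E. bexp (E - {e}) x (\<lambda>\<omega>. f (insert e \<omega>) - f \<omega>))"
    using assms x by (intro sum_nonneg bexp_nonneg) (auto simp: subset_iff)
  then show "\<exists>y. ((\<lambda>p. bexp E p f) has_real_derivative y) (at x) \<and> 0 \<le> y"
    using bexp_has_derivative[OF assms(1)] by blast
qed

text \<open>
  Insertion tolerance: forcing \<open>e\<close> open costs a factor \<open>p\<close>.
\<close>

lemma bexp_open_edge:
  assumes "finite E" "0 \<le> p" "p \<le> 1" "e \<in> E"
    and "\<And>\<omega>. \<omega> \<subseteq> E \<Longrightarrow> 0 \<le> g \<omega>"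
    and "\<And>\<omega>. \<omega> \<subseteq> E \<Longrightarrow> f \<omega> \<le> g (insert e \<omega>)"
  shows "p * bexp E p f \<le> bexp E p g"
proof -
  have "bexp E p f \<le> bexp E p (\<lambda>\<omega>. g (insert e \<omega>))"
    using assms by (intro bexp_mono)
  also have "\<dots> = bexp (E - {e}) p (\<lambda>\<omega>. g (insert e \<omega>))"
    using assms by (simp add: bexp_remove[of E e] algebra_simps)
  finally have "p * bexp E p f \<le> p * bexp (E - {e}) p (\<lambda>\<omega>. g (insert e \<omega>))"
    using assms(2) by (rule mult_left_mono)
  also have "\<dots> \<le> bexp E p g"
    using assms bexp_nonneg[of p "E - {e}" g] by (simp add: bexp_remove[of E e] subset_iff)
  finally show ?thesis .
qed

text \<open>
  The spatial Markov property. The hypothesis says that the region \<open>K \<omega>\<close> can be explored by looking only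
  at the edges in \<open>T (K \<omega>)\<close>; the remaining edges then keep their product law. The proof splits over
  the finitely many values \<open>k\<close> of \<open>K\<close>, on each of which the two groups of edges are independent.
\<close>

lemma bexp_spatial_Markov:
  fixes K :: "'e set \<Rightarrow> 'k" and T :: "'k \<Rightarrow> 'e set"
  assumes fin: "finite E"
    and stop: "\<And>\<omega> \<omega>'. \<omega> \<subseteq> E \<Longrightarrow> \<omega>' \<subseteq> E \<Longrightarrow> \<omega> \<inter> T (K \<omega>) = \<omega>' \<inter> T (K \<omega>) \<Longrightarrow> K \<omega>' = K \<omega>"
  shows "bexp E p (\<lambda>\<omega>. F (K \<omega>) (\<omega> - T (K \<omega>))) = bexp E p (\<lambda>\<omega>. bexp (E - T (K \<omega>)) p (F (K \<omega>)))"
proof -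
  let ?R = "K ` Pow E"
  have finR: "finite ?R"
    using fin by simp
  have split: "bexp E p (\<lambda>\<omega>. H (K \<omega>) \<omega>) = (\<Sum>k\<in>?R. bexp E p (\<lambda>\<omega>. of_bool (K \<omega> = k) * H k \<omega>))"
    for H :: "'k \<Rightarrow> 'e set \<Rightarrow> real"
    unfolding bexp_sum[symmetric]
  proof (rule bexp_cong)
    fix \<omega> assume "\<omega> \<subseteq> E"
    then have "(\<Sum>k\<in>?R. of_bool (K \<omega> = k) * H k \<omega>) = (\<Sum>k\<in>{K \<omega>}. of_bool (K \<omega> = k) * H k \<omega>)"
      using finR by (intro sum.mono_neutral_right) auto
    then show "H (K \<omega>) \<omega> = (\<Sum>k\<in>?R. of_bool (K \<omega> = k) * H k \<omega>)"
      by simp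
  qed
  have "bexp E p (\<lambda>\<omega>. of_bool (K \<omega> = k) * F k (\<omega> - T k)) =
      bexp E p (\<lambda>\<omega>. of_bool (K \<omega> = k) * bexp (E - T k) p (F k))" for k
  proof -
    have E: "E = (E \<inter> T k) \<union> (E - T k)" by blast
    have fins: "finite (E \<inter> T k)" "finite (E - T k)" "(E \<inter> T k) \<inter> (E - T k) = {}"
      using fin by auto
    have U: "bexp E p H = bexp (E \<inter> T k) p (\<lambda>\<omega>. bexp (E - T k) p (\<lambda>\<eta>. H (\<omega> \<union> \<eta>)))" for H
      using bexp_Un[OF fins, of p H] E by simp
    have K: "K (\<omega> \<union> \<eta>) = k \<longleftrightarrow> K \<omega> = k" if "\<omega> \<subseteq> E \<inter> T k" "\<eta> \<subseteq> E - T k" for \<omega> \<eta>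
    proof -
      have "(\<omega> \<union> \<eta>) \<inter> T k = \<omega> \<inter> T k" "\<omega> \<union> \<eta> \<subseteq> E" "\<omega> \<subseteq> E"
        using that by auto
      then show ?thesis
        using stop by metis
    qed
    have D: "\<omega> \<union> \<eta> - T k = \<eta>" if "\<omega> \<subseteq> E \<inter> T k" "\<eta> \<subseteq> E - T k" for \<omega> \<eta>
      using that by auto
    have "bexp E p (\<lambda>\<omega>. of_bool (K \<omega> = k) * F k (\<omega> - T k)) =
        bexp (E \<inter> T k) p (\<lambda>\<omega>. bexp (E - T k) p (\<lambda>\<eta>. of_bool (K (\<omega> \<union> \<eta>) = k) * F k (\<omega> \<union> \<eta> - T k)))"
      by (rule U)
    also have "\<dots> = bexp (E \<inter> T k) p (\<lambda>\<omega>. bexp (E - T k) p (\<lambda>\<eta>. of_bool (K \<omega> = k) * F k \<eta>))"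
      by (intro bexp_cong) (simp add: K D)
    also have "\<dots> = bexp (E \<inter> T k) p (\<lambda>\<omega>. bexp (E - T k) p (\<lambda>\<eta>. of_bool (K (\<omega> \<union> \<eta>) = k) * bexp (E - T k) p (F k)))"
    proof (rule bexp_cong)
      fix \<omega> assume w: "\<omega> \<subseteq> E \<inter> T k"
      have "bexp (E - T k) p (\<lambda>\<eta>. of_bool (K (\<omega> \<union> \<eta>) = k) * bexp (E - T k) p (F k)) =
          bexp (E - T k) p (\<lambda>\<eta>. of_bool (K \<omega> = k) * bexp (E - T k) p (F k))"
        by (intro bexp_cong) (simp add: K[OF w])
      then show "bexp (E - T k) p (\<lambda>\<eta>. of_bool (K \<omega> = k) * F k \<eta>) =
          bexp (E - T k) p (\<lambda>\<eta>. of_bool (K (\<omega> \<union> \<eta>) = k) * bexp (E - T k) p (F k))"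
        using fins by (simp add: bexp_cmult)
    qed
    also have "\<dots> = bexp E p (\<lambda>\<omega>. of_bool (K \<omega> = k) * bexp (E - T k) p (F k))"
      by (rule U[symmetric])
    finally show ?thesis .
  qed
  then show ?thesis
    using split[of "\<lambda>k \<omega>. F k (\<omega> - T k)"] split[of "\<lambda>k _. bexp (E - T k) p (F k)"] by simp
qed

section \<open>Open clusters and neighbourhoods\<close>

definition touching :: "'a set \<Rightarrow> 'a set set" where
  "touching A = {e. e \<inter> A \<noteq> {}}"

definition cluster :: "'a set set \<Rightarrow> 'a set \<Rightarrow> 'a set" where
  "cluster \<omega> A = {(x, y). {x, y} \<in> \<omega>}\<^sup>* `` A"

lemma cluster_start: "A \<subseteq> cluster \<omega> A"
  by (auto simp: cluster_def)

lemma start_in_cluster [simp, intro]: "v \<in> cluster \<omega> {v}"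
  by (auto simp: cluster_def)

lemma cluster_step: "x \<in> cluster \<omega> A \<Longrightarrow> {x, y} \<in> \<omega> \<Longrightarrow> y \<in> cluster \<omega> A"
  unfolding cluster_def by (auto intro: rtrancl_into_rtrancl)

lemma cluster_least:
  assumes "A \<subseteq> B" "\<And>x y. x \<in> B \<Longrightarrow> {x, y} \<in> \<omega> \<Longrightarrow> y \<in> B"
  shows "cluster \<omega> A \<subseteq> B"
proof
  fix z assume "z \<in> cluster \<omega> A"
  then obtain a where a: "a \<in> A" "(a, z) \<in> {(x, y). {x, y} \<in> \<omega>}\<^sup>*"
    by (auto simp: cluster_def)
  from a(2) show "z \<in> B"
    by (induction rule: rtrancl_induct) (use a assms in auto)
qed

lemma cluster_mono: "\<omega> \<subseteq> \<omega>' \<Longrightarrow> A \<subseteq> A' \<Longrightarrow> cluster \<omega> A \<subseteq> cluster \<omega>' A'"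
  using cluster_start[of A' \<omega>'] by (intro cluster_least) (auto dest: cluster_step)

lemma cluster_subset: "cluster \<omega> A \<subseteq> A \<union> \<Union>\<omega>"
  by (rule cluster_least) auto

lemma finite_cluster:
  assumes "finite \<omega>" "\<And>e. e \<in> \<omega> \<Longrightarrow> finite e" "finite A"
  shows "finite (cluster \<omega> A)"
  using cluster_subset[of \<omega> A] assms by (metis finite_Un finite_Union finite_subset)

lemma cluster_sym: "y \<in> cluster \<omega> {x} \<Longrightarrow> x \<in> cluster \<omega> {y}"
proof -
  have "sym ({(x, y). {x, y} \<in> \<omega>}\<^sup>*)"
    by (intro sym_rtrancl symI) (auto simp: insert_commute)
  then show "y \<in> cluster \<omega> {x} \<Longrightarrow> x \<in> cluster \<omega> {y}"
    unfolding cluster_def by (auto dest: symD)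
qed

lemma cluster_trans: "A \<subseteq> cluster \<omega> B \<Longrightarrow> cluster \<omega> A \<subseteq> cluster \<omega> B"
  by (rule cluster_least) (auto intro: cluster_step)

lemma cluster_eq: "y \<in> cluster \<omega> {x} \<Longrightarrow> cluster \<omega> {y} = cluster \<omega> {x}"
  by (intro equalityI cluster_trans) (auto intro: cluster_sym)

text \<open>
  A cluster is discovered by examining only the edges that touch it. This is the hypothesis of
  \<open>bexp_spatial_Markov\<close> for the exploration of a cluster from outside or from a vertex.
\<close>

lemma cluster_stopping:
  assumes "\<omega> \<inter> touching (cluster \<omega> A) = \<omega>' \<inter> touching (cluster \<omega> A)"
  shows "cluster \<omega>' A = cluster \<omega> A"
proof
  have t: "{x, y} \<in> \<omega> \<longleftrightarrow> {x, y} \<in> \<omega>'" if "x \<in> cluster \<omega> A" for x y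
  proof -
    have "{x, y} \<in> \<omega> \<inter> touching (cluster \<omega> A) \<longleftrightarrow> {x, y} \<in> \<omega>' \<inter> touching (cluster \<omega> A)"
      by (subst assms) (rule refl)
    moreover have "{x, y} \<in> touching (cluster \<omega> A)"
      using that by (auto simp: touching_def)
    ultimately show ?thesis by blast
  qed
  show "cluster \<omega>' A \<subseteq> cluster \<omega> A"
  proof (rule cluster_least[OF cluster_start])
    fix x y assume xy: "x \<in> cluster \<omega> A" "{x, y} \<in> \<omega>'"
    then have "{x, y} \<in> \<omega>" by (simp add: t)
    then show "y \<in> cluster \<omega> A" by (rule cluster_step[OF xy(1)])
  qed
  have "cluster \<omega> A \<subseteq> cluster \<omega>' A \<inter> cluster \<omega> A"
  proof (rule cluster_least)
    show "A \<subseteq> cluster \<omega>' A \<inter> cluster \<omega> A"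
      by (intro Int_greatest cluster_start)
    fix x y assume xy: "x \<in> cluster \<omega>' A \<inter> cluster \<omega> A" "{x, y} \<in> \<omega>"
    then have "{x, y} \<in> \<omega>'" by (simp add: t)
    then show "y \<in> cluster \<omega>' A \<inter> cluster \<omega> A"
      using xy by (auto intro: cluster_step)
  qed
  then show "cluster \<omega> A \<subseteq> cluster \<omega>' A" by blast
qed

lemma cluster_off_disjoint:
  assumes "A \<inter> K = {}"
  shows "cluster (\<omega> - touching K) A \<inter> K = {}"
proof -
  have "cluster (\<omega> - touching K) A \<subseteq> - K"
    using assms by (intro cluster_least) (auto simp: touching_def)
  then show ?thesis by blast
qed

lemma cluster_attach:
  assumes "y \<in> cluster \<omega> A" "z \<notin> cluster \<omega> A"
  shows "cluster \<omega> A \<union> cluster (\<omega> - touching (cluster \<omega> A)) {z} \<subseteq> cluster (insert {y, z} \<omega>) A"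
proof -
  have K: "cluster \<omega> A \<subseteq> cluster (insert {y, z} \<omega>) A"
    by (rule cluster_mono) auto
  then have "z \<in> cluster (insert {y, z} \<omega>) A"
    using assms(1) by (auto intro: cluster_step)
  then have "cluster (insert {y, z} \<omega>) {z} \<subseteq> cluster (insert {y, z} \<omega>) A"
    by (intro cluster_trans) auto
  moreover have "cluster (\<omega> - touching (cluster \<omega> A)) {z} \<subseteq> cluster (insert {y, z} \<omega>) {z}"
    by (rule cluster_mono) auto
  ultimately show ?thesis
    using K by blast
qed

lemma cluster_image:
  assumes "inj_on f W" "\<And>e. e \<in> \<omega> \<Longrightarrow> e \<subseteq> W" "A \<subseteq> W"
  shows "cluster ((`) f ` \<omega>) (f ` A) = f ` cluster \<omega> A"
proof
  have W: "cluster \<omega> A \<subseteq> W"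
    using cluster_subset[of \<omega> A] assms by blast
  show "cluster ((`) f ` \<omega>) (f ` A) \<subseteq> f ` cluster \<omega> A"
  proof (rule cluster_least)
    show "f ` A \<subseteq> f ` cluster \<omega> A"
      by (rule image_mono[OF cluster_start])
    fix x' y' assume x': "x' \<in> f ` cluster \<omega> A" and e': "{x', y'} \<in> (`) f ` \<omega>"
    from x' obtain x where x: "x' = f x" "x \<in> cluster \<omega> A" by (rule imageE)
    from e' obtain e where e: "{x', y'} = f ` e" "e \<in> \<omega>" by (rule imageE)
    have eW: "e \<subseteq> W" by (rule assms(2)[OF e(2)])
    have xW: "x \<in> W" using x(2) W by blast
    have "f x \<in> f ` e" using e(1) x(1) by auto
    then obtain a where a: "a \<in> e" "f x = f a" by (rule imageE)
    have "x = a"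
      by (rule inj_onD[OF assms(1) a(2) xW]) (use a(1) eW in blast)
    then have xe: "x \<in> e" using a(1) by simp
    have "y' \<in> f ` e" using e(1) by auto
    then obtain y where y: "y' = f y" "y \<in> e" by (rule imageE)
    have "b \<in> {x, y}" if b: "b \<in> e" for b
    proof -
      have "f b \<in> f ` e" using b by (rule imageI)
      then have "f b = f x \<or> f b = f y"
        unfolding e(1)[symmetric] x(1) y(1) by simp
      moreover have "b \<in> W" "y \<in> W"
        using b y(2) eW by auto
      ultimately show ?thesis
        using inj_onD[OF assms(1)] xW by blast
    qed
    then have "e = {x, y}" using xe y(2) by blast
    then have "y \<in> cluster \<omega> A"
      using e(2) cluster_step[OF x(2)] by simp
    then show "y' \<in> f ` cluster \<omega> A"
      using y by blast
  qed
  show "f ` cluster \<omega> A \<subseteq> cluster ((`) f ` \<omega>) (f ` A)"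
  proof -
    have "cluster \<omega> A \<subseteq> {x. f x \<in> cluster ((`) f ` \<omega>) (f ` A)}"
    proof (rule cluster_least)
      show "A \<subseteq> {x. f x \<in> cluster ((`) f ` \<omega>) (f ` A)}"
        using cluster_start[of "f ` A" "(`) f ` \<omega>"] by blast
      fix x y assume x: "x \<in> {x. f x \<in> cluster ((`) f ` \<omega>) (f ` A)}" and e: "{x, y} \<in> \<omega>"
      have "{f x, f y} \<in> (`) f ` \<omega>"
        using imageI[OF e, of "(`) f"] by simp
      then show "y \<in> {x. f x \<in> cluster ((`) f ` \<omega>) (f ` A)}"
        using x cluster_step by simp
    qed
    then show ?thesis by blast
  qed
qed

fun nbhd :: "'a ugraph \<Rightarrow> nat \<Rightarrow> 'a set \<Rightarrow> 'a set" where
  "nbhd G 0 A = A"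
| "nbhd G (Suc i) A = nbhd G i A \<union> (\<Union>x\<in>nbhd G i A. nbrs G x)"

definition edges_inside :: "'a ugraph \<Rightarrow> 'a set \<Rightarrow> 'a set set" where
  "edges_inside G A = {e \<in> edges G. e \<subseteq> A}"

definition edge_boundary :: "'a ugraph \<Rightarrow> 'a set \<Rightarrow> ('a \<times> 'a) set" where
  "edge_boundary G k = {(y, z). y \<in> k \<and> z \<notin> k \<and> {y, z} \<in> edges G}"

lemma nbrs_iff: "y \<in> nbrs G x \<longleftrightarrow> {x, y} \<in> edges G"
  by (simp add: nbrs_def adj_def)

lemma nbhd_add: "nbhd G i (nbhd G j A) = nbhd G (i + j) A"
  by (induction i) auto

lemma nbhd_mono: "i \<le> j \<Longrightarrow> A \<subseteq> B \<Longrightarrow> nbhd G i A \<subseteq> nbhd G j B"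
proof (induction j arbitrary: i)
  case (Suc j)
  show ?case
  proof (cases i)
    case 0
    then show ?thesis using Suc.IH[of 0] Suc.prems by auto
  next
    case (Suc i')
    then show ?thesis using Suc.IH[of i'] Suc.prems by fastforce
  qed
qed auto

lemma nbhd_self: "A \<subseteq> nbhd G i A"
  using nbhd_mono[of 0 i A A G] by simp

lemma nbhd_step: "x \<in> nbhd G i A \<Longrightarrow> {x, y} \<in> edges G \<Longrightarrow> y \<in> nbhd G (Suc i) A"
  by (auto simp: nbrs_iff)

lemma edges_inside_mono: "A \<subseteq> B \<Longrightarrow> edges_inside G A \<subseteq> edges_inside G B"
  by (auto simp: edges_inside_def)

locale lf_graph =
  fixes G :: "'a ugraph"
  assumes simple: "simple_graph G" and lf: "locally_finite_graph G"
begin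

lemma edgeE:
  assumes "e \<in> edges G"
  obtains x y where "x \<in> verts G" "y \<in> verts G" "x \<noteq> y" "e = {x, y}"
  using simple assms by (auto simp: simple_graph_def)

lemma edge_verts: "{x, y} \<in> edges G \<Longrightarrow> x \<in> verts G \<and> y \<in> verts G \<and> x \<noteq> y"
  by (erule edgeE) (auto simp: doubleton_eq_iff)

lemma finite_nbrs: "finite (nbrs G x)"
proof (cases "x \<in> verts G")
  case True
  then show ?thesis using lf by (auto simp: locally_finite_graph_def)
next
  case False
  then have "nbrs G x = {}" by (auto simp: nbrs_iff dest: edge_verts)
  then show ?thesis by simp
qed

lemma nbhd_verts: "A \<subseteq> verts G \<Longrightarrow> nbhd G i A \<subseteq> verts G"
  by (induction i) (auto simp: nbrs_iff dest: edge_verts)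

lemma finite_nbhd: "finite A \<Longrightarrow> finite (nbhd G i A)"
  by (induction i) (auto simp: finite_nbrs)

lemma finite_edges_inside: "finite A \<Longrightarrow> finite (edges_inside G A)"
  by (rule finite_subset[of _ "Pow A"]) (auto simp: edges_inside_def)

lemma finite_edge_boundary: "finite k \<Longrightarrow> finite (edge_boundary G k)"
  by (rule finite_subset[of _ "k \<times> (\<Union>y\<in>k. nbrs G y)"])
     (auto simp: edge_boundary_def nbrs_iff finite_nbrs)

lemma finite_edge: "e \<in> edges G \<Longrightarrow> finite e"
  by (erule edgeE) auto

lemma relpow_adj_iff: "x \<in> nbhd G R {v} \<longleftrightarrow> (\<exists>k\<le>R. (v, x) \<in> adj G ^^ k)"
proof (induction R arbitrary: x)
  case (Suc R)
  have "x \<in> nbhd G (Suc R) {v} \<longleftrightarrow>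
      (\<exists>k\<le>R. (v, x) \<in> adj G ^^ k) \<or> (\<exists>y. (\<exists>k\<le>R. (v, y) \<in> adj G ^^ k) \<and> (y, x) \<in> adj G)"
    using Suc by (auto simp: nbrs_def)
  also have "\<dots> \<longleftrightarrow> (\<exists>k\<le>Suc R. (v, x) \<in> adj G ^^ k)"
  proof
    assume "\<exists>k\<le>Suc R. (v, x) \<in> adj G ^^ k"
    then obtain k where k: "k \<le> Suc R" "(v, x) \<in> adj G ^^ k" by blast
    show "(\<exists>k\<le>R. (v, x) \<in> adj G ^^ k) \<or> (\<exists>y. (\<exists>k\<le>R. (v, y) \<in> adj G ^^ k) \<and> (y, x) \<in> adj G)"
    proof (cases k)
      case (Suc k')
      then obtain y where "(v, y) \<in> adj G ^^ k'" "(y, x) \<in> adj G"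
        using k by auto
      then show ?thesis using k Suc by auto
    qed (use k in auto)
  next
    assume "(\<exists>k\<le>R. (v, x) \<in> adj G ^^ k) \<or> (\<exists>y. (\<exists>k\<le>R. (v, y) \<in> adj G ^^ k) \<and> (y, x) \<in> adj G)"
    then show "\<exists>k\<le>Suc R. (v, x) \<in> adj G ^^ k"
    proof
      assume "\<exists>y. (\<exists>k\<le>R. (v, y) \<in> adj G ^^ k) \<and> (y, x) \<in> adj G"
      then obtain y k where "k \<le> R" "(v, y) \<in> adj G ^^ k" "(y, x) \<in> adj G" by blast
      then have "(v, x) \<in> adj G ^^ Suc k" "Suc k \<le> Suc R" by auto
      then show ?thesis by blast
    qed (auto intro: le_SucI)
  qed
  finally show ?case .
qed auto

lemma gdist_le_iff: "gdist G v x \<le> enat R \<longleftrightarrow> (\<exists>k\<le>R. (v, x) \<in> adj G ^^ k)"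
proof
  assume le: "gdist G v x \<le> enat R"
  let ?S = "enat ` {k. (v, x) \<in> adj G ^^ k}"
  have "?S \<noteq> {}"
  proof
    assume "?S = {}"
    then have "gdist G v x = \<infinity>"
      unfolding gdist_def by (simp only: Inf_enat_def) simp
    then show False using le by simp
  qed
  then obtain s where "s \<in> ?S" by (meson ex_in_conv)
  then have "Inf ?S \<in> ?S"
    by (rule wellorder_InfI)
  then show "\<exists>k\<le>R. (v, x) \<in> adj G ^^ k"
    using le by (auto simp: gdist_def)
next
  assume "\<exists>k\<le>R. (v, x) \<in> adj G ^^ k"
  then obtain k where "k \<le> R" "(v, x) \<in> adj G ^^ k" by blast
  then show "gdist G v x \<le> enat R"
    unfolding gdist_def by (intro INF_lower2[of k]) auto
qed

lemma gball_eq_nbhd: "v \<in> verts G \<Longrightarrow> gball G v R = nbhd G R {v}"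
  using nbhd_verts[of "{v}" R] by (auto simp: gball_def gdist_le_iff relpow_adj_iff)

text \<open>
  A cluster that leaves the ball of radius \<open>i\<close> meets each of its \<open>i + 1\<close> layers.
\<close>

lemma cluster_layers:
  assumes "\<omega> \<subseteq> edges G" "finite (cluster \<omega> {v})"
  shows "cluster \<omega> {v} \<subseteq> nbhd G i {v} \<or> i < card (cluster \<omega> {v} \<inter> nbhd G i {v})"
proof (induction i)
  case 0
  have "cluster \<omega> {v} \<inter> {v} = {v}" by auto
  then show ?case by simp
next
  case (Suc i)
  show ?case
  proof (cases "cluster \<omega> {v} \<subseteq> nbhd G i {v}")
    case False
    obtain x y where xy: "x \<in> cluster \<omega> {v} \<inter> nbhd G i {v}" "{x, y} \<in> \<omega>"
      "y \<notin> cluster \<omega> {v} \<inter> nbhd G i {v}"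
    proof (rule ccontr)
      assume "\<not> thesis"
      then have "cluster \<omega> {v} \<subseteq> cluster \<omega> {v} \<inter> nbhd G i {v}"
        using that nbhd_self[of "{v}" G i] by (intro cluster_least) auto
      then show False using False by blast
    qed
    then have y: "y \<in> cluster \<omega> {v}" "y \<notin> nbhd G i {v}" "y \<in> nbhd G (Suc i) {v}"
      using assms nbhd_step[of x G i "{v}" y] cluster_step[of x \<omega> "{v}" y] by auto
    then have "insert y (cluster \<omega> {v} \<inter> nbhd G i {v}) \<subseteq> cluster \<omega> {v} \<inter> nbhd G (Suc i) {v}"
      by auto
    from card_mono[OF _ this] show ?thesis
      using Suc False y assms(2) by auto
  qed auto
qed

lemma cluster_subset_nbhd:
  assumes "\<omega> \<subseteq> edges G" "finite (cluster \<omega> {v})" "card (cluster \<omega> {v}) \<le> Suc i"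
  shows "cluster \<omega> {v} \<subseteq> nbhd G i {v}"
proof (rule ccontr)
  assume "\<not> ?thesis"
  moreover from this have "i < card (cluster \<omega> {v} \<inter> nbhd G i {v})"
    using cluster_layers[OF assms(1,2), of i] by blast
  then have "card (cluster \<omega> {v} \<inter> nbhd G i {v}) = card (cluster \<omega> {v})"
    using assms card_mono[OF assms(2), of "cluster \<omega> {v} \<inter> nbhd G i {v}"] by simp
  then have "cluster \<omega> {v} \<inter> nbhd G i {v} = cluster \<omega> {v}"
    using assms by (intro card_subset_eq) auto
  ultimately show False by blast
qed

text \<open>
  If the part of the cluster that is reached inside the ball of radius \<open>N\<close> has fewer than \<open>N\<close> vertices, it
  stays at distance less than \<open>N\<close>, so no open edge leads out of it and it is the whole cluster.
\<close>

lemma large_cluster_local: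
  assumes "\<omega> \<subseteq> edges G"
  shows "infinite (cluster \<omega> {v}) \<or> N \<le> card (cluster \<omega> {v}) \<longleftrightarrow>
    N \<le> card (cluster (\<omega> \<inter> edges_inside G (nbhd G N {v})) {v})"
proof -
  let ?\<omega> = "\<omega> \<inter> edges_inside G (nbhd G N {v})"
  let ?C = "cluster ?\<omega> {v}"
  have sub: "?C \<subseteq> cluster \<omega> {v}"
    by (rule cluster_mono) auto
  have fin: "finite ?C"
    using finite_edges_inside[of "nbhd G N {v}"] finite_nbhd
    by (intro finite_cluster) (auto simp: edges_inside_def intro: finite_edge)
  show ?thesis
  proof (cases "N \<le> card ?C")
    case True
    then show ?thesis
      using card_mono[OF _ sub] by (cases "finite (cluster \<omega> {v})") auto
  next
    case False
    then obtain M where M: "N = Suc M" "card ?C \<le> M"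
      by (cases N) auto
    have near: "?C \<subseteq> nbhd G M {v}"
      using M fin by (intro cluster_subset_nbhd) (auto simp: edges_inside_def)
    have "cluster \<omega> {v} \<subseteq> ?C"
    proof (rule cluster_least)
      fix x y assume xy: "x \<in> ?C" "{x, y} \<in> \<omega>"
      then have "x \<in> nbhd G M {v}" using near by blast
      then have "x \<in> nbhd G N {v}" "y \<in> nbhd G N {v}"
        using M xy assms nbhd_step[of x G M "{v}" y] by auto
      then have "{x, y} \<in> ?\<omega>"
        using xy assms by (auto simp: edges_inside_def)
      then show "y \<in> ?C"
        using xy cluster_step by metis
    qed auto
    then have "cluster \<omega> {v} = ?C" using sub by blast
    then show ?thesis using fin by simp
  qed
qed

end

section \<open>Large clusters seen from an explored cluster\<close>

lemma bexp_minus: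
  assumes "finite E"
  shows "bexp E p (\<lambda>\<omega>. f (\<omega> - T)) = bexp (E - T) p f"
proof -
  have "bexp E p (\<lambda>\<omega>. f (\<omega> - T)) = bexp E p (\<lambda>\<omega>. f (\<omega> \<inter> (E - T)))"
  proof (rule bexp_cong)
    fix \<omega> assume "\<omega> \<subseteq> E"
    then have "\<omega> - T = \<omega> \<inter> (E - T)" by blast
    then show "f (\<omega> - T) = f (\<omega> \<inter> (E - T))" by simp
  qed
  then show ?thesis
    using bexp_marginal[OF assms, of "E - T" p f] by auto
qed

text \<open>
  The probability \<open>\<theta>\<^sub>N(p)\<close> that the cluster of \<open>v\<close> has at least \<open>N\<close> vertices. Restricting to the edges of
  the ball of radius \<open>N\<close> is harmless by \<open>large_cluster_local\<close>, and makes it a finite sum.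
\<close>

definition tailp :: "'a ugraph \<Rightarrow> real \<Rightarrow> nat \<Rightarrow> 'a \<Rightarrow> real" where
  "tailp G p N v =
    bexp (edges_inside G (nbhd G N {v})) p (\<lambda>\<omega>. of_bool (N \<le> card (cluster \<omega> {v})))"

context lf_graph
begin

lemma finite_open_cluster: "finite \<omega> \<Longrightarrow> \<omega> \<subseteq> edges G \<Longrightarrow> finite (cluster \<omega> {v})"
  by (intro finite_cluster) (auto intro: finite_edge)

lemma finite_ball_edges: "finite (edges_inside G (nbhd G i {v}))"
  by (intro finite_edges_inside finite_nbhd) auto

lemma tailp_eq:
  assumes E: "finite E" "E \<subseteq> edges G" "edges_inside G (nbhd G N {v}) \<subseteq> E"
  shows "bexp E p (\<lambda>\<omega>. of_bool (N \<le> card (cluster \<omega> {v}))) = tailp G p N v"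
proof -
  let ?I = "edges_inside G (nbhd G N {v})"
  have "bexp E p (\<lambda>\<omega>. of_bool (N \<le> card (cluster \<omega> {v}))) =
      bexp E p (\<lambda>\<omega>. of_bool (N \<le> card (cluster (\<omega> \<inter> ?I) {v})))"
  proof (rule bexp_cong)
    fix \<omega> assume w: "\<omega> \<subseteq> E"
    then have "finite (cluster \<omega> {v})"
      using E finite_subset by (intro finite_open_cluster) auto
    then show "of_bool (N \<le> card (cluster \<omega> {v})) = (of_bool (N \<le> card (cluster (\<omega> \<inter> ?I) {v})) :: real)"
      using large_cluster_local[of \<omega> v N] w E by auto
  qed
  then show ?thesis
    unfolding tailp_def using bexp_marginal[OF E(1,3), of p "\<lambda>\<omega>. of_bool (N \<le> card (cluster \<omega> {v}))"] by simp
qed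

lemma card_cluster_mono:
  assumes "finite E" "E \<subseteq> edges G" "\<omega> \<subseteq> E" "e \<in> E"
  shows "card (cluster \<omega> {v}) \<le> card (cluster (insert e \<omega>) {v})"
proof (rule card_mono)
  show "finite (cluster (insert e \<omega>) {v})"
    using assms finite_subset by (intro finite_open_cluster) auto
qed (auto intro: cluster_mono[THEN subsetD])

lemma tailp_mono:
  assumes "0 \<le> p" "p \<le> q" "q \<le> 1"
  shows "tailp G p N v \<le> tailp G q N v"
  unfolding tailp_def
proof (rule bexp_mono_prob[OF finite_ball_edges assms])
  fix \<omega> e assume "\<omega> \<subseteq> edges_inside G (nbhd G N {v})" "e \<in> edges_inside G (nbhd G N {v})"
  then have "card (cluster \<omega> {v}) \<le> card (cluster (insert e \<omega>) {v})"
    by (intro card_cluster_mono[OF finite_ball_edges]) (auto simp: edges_inside_def)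
  then show "(of_bool (N \<le> card (cluster \<omega> {v})) :: real) \<le> of_bool (N \<le> card (cluster (insert e \<omega>) {v}))"
    by auto
qed

lemma tailp_antimono:
  assumes "0 \<le> p" "p \<le> 1" "N \<le> M"
  shows "tailp G p M v \<le> tailp G p N v"
proof -
  have "tailp G p M v \<le> bexp (edges_inside G (nbhd G M {v})) p (\<lambda>\<omega>. of_bool (N \<le> card (cluster \<omega> {v})))"
    unfolding tailp_def using assms by (intro bexp_mono) auto
  also have "\<dots> = tailp G p N v"
    using assms(3) nbhd_mono[of N M "{v}" "{v}" G]
    by (intro tailp_eq finite_ball_edges edges_inside_mono) (auto simp: edges_inside_def)
  finally show ?thesis .
qed

lemma tailp_nonneg: "0 \<le> p \<Longrightarrow> p \<le> 1 \<Longrightarrow> 0 \<le> tailp G p N v"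
  unfolding tailp_def by (intro bexp_nonneg) auto

lemma bexp_cluster_Markov:
  assumes "finite E"
  shows "bexp E p (\<lambda>\<omega>. F (cluster \<omega> A) (\<omega> - touching (cluster \<omega> A))) =
    bexp E p (\<lambda>\<omega>. bexp (E - touching (cluster \<omega> A)) p (F (cluster \<omega> A)))"
  using assms by (rule bexp_spatial_Markov) (rule cluster_stopping)

end

text \<open>
  The only consequence of transitivity that the percolation estimates use.
\<close>

locale homogeneous_graph = lf_graph +
  assumes homogeneous: "v \<in> verts G \<Longrightarrow> w \<in> verts G \<Longrightarrow> tailp G p N v = tailp G p N w"

locale expander = homogeneous_graph +
  fixes d :: nat and lam :: real
  assumes degree: "x \<in> verts G \<Longrightarrow> card (nbrs G x) \<le> d"
    and expansion: "finite k \<Longrightarrow> k \<subseteq> verts G \<Longrightarrow> (1 + lam) * card k \<le> card (nbhd G 1 k)"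
    and lam: "0 < lam"
begin

lemma expansion_iterated:
  assumes "finite k" "k \<subseteq> verts G"
  shows "(1 + lam) ^ r * card k \<le> card (nbhd G r k)"
proof (induction r)
  case (Suc r)
  have "(1 + lam) * ((1 + lam) ^ r * card k) \<le> (1 + lam) * card (nbhd G r k)"
    using Suc lam by (intro mult_left_mono) auto
  also have "\<dots> \<le> card (nbhd G 1 (nbhd G r k))"
    using assms by (intro expansion finite_nbhd nbhd_verts)
  finally show ?case by (simp add: nbhd_add mult.assoc del: nbhd.simps)
qed auto

text \<open>
  Here \<open>k\<close> plays the role of an explored cluster, and the configuration off \<open>k\<close> is fresh. Sample all edges
  anew: a vertex \<open>z\<close> near \<open>k\<close> has a cluster of size at least \<open>N\<close> with probability \<open>\<theta>\<^sub>N\<close>. Either this already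
  happens off \<open>k\<close>, or the cluster of \<open>z\<close> off \<open>k\<close> has fewer than \<open>N\<close> vertices and contains an endpoint of a
  boundary edge of \<open>k\<close>. Summed over \<open>z\<close>, the second alternative counts the vertices of small clusters that
  hang off boundary edges, which is at most the sum on the right. In the first alternative open a path of
  length at most \<open>r\<close> from \<open>k\<close> to \<open>z\<close>; the boundary edge where it leaves \<open>k\<close> then sees \<open>N\<close> vertices, and this
  pays for the factor \<open>((1 + d) / p)^r\<close>, which counts the vertices \<open>z\<close> and the cost of the paths.
\<close>

lemma fresh_large_cluster:
  assumes k: "finite k" "k \<subseteq> verts G"
    and E: "finite E" "E \<subseteq> edges G" "\<And>z. z \<in> nbhd G r k \<Longrightarrow> edges_inside G (nbhd G N {z}) \<subseteq> E"
    and p: "0 < p" "p \<le> 1" and N: "1 \<le> N" and r: "((1 + d) / p) ^ r \<le> N"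
    and w: "w \<in> verts G"
  shows "tailp G p N w * card (nbhd G r k - k) \<le>
    2 * (\<Sum>(y, z)\<in>edge_boundary G k.
           bexp (E - touching k) p (\<lambda>\<eta>. real (min (card (cluster \<eta> {z})) N)))"
proof -
  let ?B = "edge_boundary G k" and ?E = "E - touching k"
  \<comment> \<open>\<open>q z\<close> is the probability of a large cluster off \<open>k\<close>, \<open>m z\<close> the truncated mean size of that cluster.\<close>
  define q where "q z = bexp ?E p (\<lambda>\<eta>. of_bool (N \<le> card (cluster \<eta> {z})))" for z
  define m where "m z = bexp ?E p (\<lambda>\<eta>. real (min (card (cluster \<eta> {z})) N))" for z
  define c where "c = (1 + real d) / p"
  have c1: "1 \<le> c" using p by (simp add: c_def)
  have finB: "finite ?B" using k(1) by (rule finite_edge_boundary)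
  have finE: "finite ?E" using E by simp
  have finC: "finite (cluster \<eta> {z})" if "\<eta> \<subseteq> E" for \<eta> z
    using that E finite_subset by (intro finite_open_cluster) auto
  have q0: "0 \<le> q z" and m0: "0 \<le> m z" for z
    unfolding q_def m_def using p by (auto intro!: bexp_nonneg)
  have qm: "N * q z \<le> m z" for z
    unfolding q_def m_def bexp_cmult[symmetric] using p by (intro bexp_mono) auto
  \<comment> \<open>the two alternatives, with a union bound over the boundary edge that joins \<open>z\<close> to \<open>k\<close>\<close>
  have dich: "tailp G p N w \<le> q z + (\<Sum>(y, z')\<in>?B.
      bexp ?E p (\<lambda>\<eta>. of_bool (z \<in> cluster \<eta> {z'} \<and> card (cluster \<eta> {z'}) < N)))"
    if z: "z \<in> nbhd G r k - k" for z
  proof -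
    let ?g = "\<lambda>\<eta>. of_bool (N \<le> card (cluster \<eta> {z})) +
      (\<Sum>(y, z')\<in>?B. of_bool (z \<in> cluster \<eta> {z'} \<and> card (cluster \<eta> {z'}) < N)) :: real"
    have "z \<in> verts G" using z nbhd_verts[OF k(2)] by blast
    then have "tailp G p N w = tailp G p N z" using w homogeneous by blast
    also have "\<dots> = bexp E p (\<lambda>\<omega>. of_bool (N \<le> card (cluster \<omega> {z})))"
      using E z by (intro tailp_eq[symmetric]) auto
    also have "\<dots> \<le> bexp E p (\<lambda>\<omega>. ?g (\<omega> - touching k))"
    proof (rule bexp_mono)
      fix \<omega> assume \<omega>: "\<omega> \<subseteq> E"
      let ?\<eta> = "\<omega> - touching k"
      let ?C = "cluster ?\<eta> {z}"
      have s0: "0 \<le> (\<Sum>(y, z')\<in>?B. of_bool (z \<in> cluster ?\<eta> {z'} \<and> card (cluster ?\<eta> {z'}) < N) :: real)"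
        by (intro sum_nonneg) auto
      show "of_bool (N \<le> card (cluster \<omega> {z})) \<le> ?g ?\<eta>"
      proof (cases "N \<le> card (cluster \<omega> {z}) \<and> card ?C < N")
        case True
        then have "\<not> cluster \<omega> {z} \<subseteq> ?C"
          using card_mono[of ?C "cluster \<omega> {z}"] finC[of ?\<eta> z] \<omega> by auto
        then obtain x y where xy: "x \<in> ?C" "{x, y} \<in> \<omega>" "y \<notin> ?C"
          using cluster_least[of "{z}" ?C \<omega>] by blast
        have "{x, y} \<in> touching k"
          using xy cluster_step[of x ?\<eta> "{z}" y] by auto
        moreover have "x \<notin> k"
          using cluster_off_disjoint[of "{z}" k \<omega>] z xy by blast
        ultimately have "(y, x) \<in> ?B"
          using xy \<omega> E by (auto simp: edge_boundary_def touching_def insert_commute)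
        moreover have "z \<in> cluster ?\<eta> {x}" "card (cluster ?\<eta> {x}) < N"
          using xy cluster_sym[OF xy(1)] cluster_eq[OF xy(1)] True by auto
        ultimately have "1 \<le> (\<Sum>(y, z')\<in>?B. of_bool (z \<in> cluster ?\<eta> {z'} \<and> card (cluster ?\<eta> {z'}) < N) :: real)"
          using member_le_sum[of "(y, x)" ?B "\<lambda>(y, z'). of_bool (z \<in> cluster ?\<eta> {z'} \<and> card (cluster ?\<eta> {z'}) < N) :: real"] finB
          by auto
        then show ?thesis by simp
      qed (use s0 in auto)
    qed (use p in auto)
    also have "\<dots> = bexp ?E p ?g"
      using E(1) by (rule bexp_minus)
    also have "\<dots> = q z + (\<Sum>(y, z')\<in>?B.
      bexp ?E p (\<lambda>\<eta>. of_bool (z \<in> cluster \<eta> {z'} \<and> card (cluster \<eta> {z'}) < N)))"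
      by (simp add: bexp_add bexp_sum q_def case_prod_unfold)
    finally show ?thesis .
  qed
  have finZ: "finite (nbhd G i k - k)" for i
    using k finite_nbhd by auto
  have small: "(\<Sum>z\<in>nbhd G r k - k. \<Sum>(y, z')\<in>?B.
      bexp ?E p (\<lambda>\<eta>. of_bool (z \<in> cluster \<eta> {z'} \<and> card (cluster \<eta> {z'}) < N))) \<le> (\<Sum>(y, z')\<in>?B. m z')"
  proof (subst sum.swap, rule sum_mono, clarify)
    fix y z'
    show "(\<Sum>z\<in>nbhd G r k - k. bexp ?E p (\<lambda>\<eta>. of_bool (z \<in> cluster \<eta> {z'} \<and> card (cluster \<eta> {z'}) < N))) \<le> m z'"
      unfolding m_def bexp_sum[symmetric]
    proof (rule bexp_mono)
      fix \<eta> assume \<eta>: "\<eta> \<subseteq> ?E"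
      let ?C = "cluster \<eta> {z'}"
      have fin: "finite ?C" using finC \<eta> by auto
      have "(\<Sum>z\<in>nbhd G r k - k. of_bool (z \<in> ?C \<and> card ?C < N) :: real) =
          of_bool (card ?C < N) * card ((nbhd G r k - k) \<inter> ?C)"
        using finZ[of r] by (auto simp: of_bool_def sum.If_cases Int_def)
      also have "\<dots> \<le> of_bool (card ?C < N) * card ?C"
        using fin by (auto intro!: card_mono)
      also have "\<dots> \<le> min (card ?C) N" by auto
      finally show "(\<Sum>z\<in>nbhd G r k - k. of_bool (z \<in> ?C \<and> card ?C < N) :: real) \<le> min (card ?C) N" .
    qed (use p in auto)
  qed
  \<comment> \<open>opening one edge moves a large cluster to a neighbour\<close>
  have step: "q z \<le> q v / p" if "{v, z} \<in> ?E" for v z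
  proof -
    have "p * q z \<le> q v"
      unfolding q_def
    proof (rule bexp_open_edge[OF finE _ _ that])
      fix \<eta> assume \<eta>: "\<eta> \<subseteq> ?E"
      have "z \<in> cluster (insert {v, z} \<eta>) {v}"
        by (rule cluster_step[of v]) auto
      then have "cluster (insert {v, z} \<eta>) {z} = cluster (insert {v, z} \<eta>) {v}"
        by (rule cluster_eq)
      moreover have "card (cluster \<eta> {z}) \<le> card (cluster (insert {v, z} \<eta>) {z})"
        using \<eta> that E by (intro card_cluster_mono[OF E(1)]) auto
      ultimately show "of_bool (N \<le> card (cluster \<eta> {z})) \<le>
          (of_bool (N \<le> card (cluster (insert {v, z} \<eta>) {v})) :: real)"
        by auto
    qed (use p in auto)
    then show ?thesis using p by (simp add: field_simps)
  qed
  \<comment> \<open>peel off the neighbourhoods of \<open>k\<close> one layer at a time, down to the outer endpoints of boundary edges\<close>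
  have far: "(\<Sum>z\<in>nbhd G (Suc i) k - k. q z) \<le> c ^ i * (\<Sum>(y, z)\<in>?B. q z)" if "Suc i \<le> r" for i
    using that
  proof (induction i)
    case 0
    have "nbhd G (Suc 0) k - k \<subseteq> snd ` ?B"
      by (force simp: edge_boundary_def nbrs_iff)
    then have "(\<Sum>z\<in>nbhd G (Suc 0) k - k. q z) \<le> (\<Sum>z\<in>snd ` ?B. q z)"
      using finB q0 by (intro sum_mono2) auto
    also have "\<dots> \<le> (\<Sum>b\<in>?B. q (snd b))"
      using sum_image_le[of ?B q snd] finB q0 by (auto simp: o_def)
    finally show ?case by (simp add: case_prod_unfold)
  next
    case (Suc i)
    let ?Z = "nbhd G (Suc i) k - k"
    let ?A = "\<lambda>v. insert v (nbrs G v - k)"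
    have finA: "finite (?A v)" for v using finite_nbrs by auto
    have sub: "nbhd G (Suc (Suc i)) k - k \<subseteq> snd ` Sigma ?Z ?A"
    proof
      fix z assume z: "z \<in> nbhd G (Suc (Suc i)) k - k"
      show "z \<in> snd ` Sigma ?Z ?A"
      proof (cases "z \<in> nbhd G (Suc i) k")
        case True
        then show ?thesis
          using z by (intro image_eqI[of _ snd "(z, z)"]) (auto simp del: nbhd.simps)
      next
        case False
        then obtain v where v: "v \<in> nbhd G (Suc i) k" "z \<in> nbrs G v"
          using z by (auto simp: nbhd.simps(2)[of G "Suc i"] simp del: nbhd.simps)
        have "v \<notin> k"
        proof
          assume "v \<in> k"
          then have "z \<in> nbhd G 1 k" using v by auto
          then show False
            using False nbhd_mono[of 1 "Suc i" k k G] by auto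
        qed
        then show ?thesis
          using v z by (intro image_eqI[of _ snd "(v, z)"]) (auto simp del: nbhd.simps)
      qed
    qed
    have "(\<Sum>z\<in>nbhd G (Suc (Suc i)) k - k. q z) \<le> (\<Sum>z\<in>snd ` Sigma ?Z ?A. q z)"
      using finZ finA q0 by (intro sum_mono2 sub finite_imageI finite_SigmaI) (auto simp del: nbhd.simps)
    also have "\<dots> \<le> (\<Sum>x\<in>Sigma ?Z ?A. q (snd x))"
      using sum_image_le[of "Sigma ?Z ?A" q snd] finZ[of "Suc i"] finA q0
      by (auto simp: o_def simp del: nbhd.simps)
    also have "\<dots> = (\<Sum>v\<in>?Z. \<Sum>z\<in>?A v. q z)"
      using finZ[of "Suc i"] finA by (subst sum.Sigma) (auto simp: case_prod_unfold simp del: nbhd.simps)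
    also have "\<dots> \<le> (\<Sum>v\<in>?Z. c * q v)"
    proof (rule sum_mono)
      fix v assume v: "v \<in> ?Z"
      then have vV: "v \<in> verts G" using nbhd_verts[OF k(2)] by blast
      have near: "q z \<le> q v / p" if z: "z \<in> nbrs G v - k" for z
      proof (rule step)
        have "v \<in> nbhd G r k"
          using v Suc.prems nbhd_mono[of "Suc i" r k k G] by auto
        then have "edges_inside G (nbhd G N {v}) \<subseteq> E" by (rule E(3))
        moreover have "{v, z} \<in> edges_inside G (nbhd G 1 {v})"
          using z by (auto simp: edges_inside_def nbrs_iff)
        then have "{v, z} \<in> edges_inside G (nbhd G N {v})"
          using edges_inside_mono[OF nbhd_mono[OF N subset_refl, of G "{v}"], of G] by blast
        ultimately show "{v, z} \<in> ?E"
          using v z by (auto simp: touching_def)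
      qed
      have "v \<notin> nbrs G v" using edge_verts[of v v] by (auto simp: nbrs_iff)
      then have "(\<Sum>z\<in>?A v. q z) = q v + (\<Sum>z\<in>nbrs G v - k. q z)"
        using finite_nbrs by simp
      also have "\<dots> \<le> q v + (\<Sum>z\<in>nbrs G v - k. q v / p)"
        using near by (intro add_left_mono sum_mono)
      also have "\<dots> = q v + card (nbrs G v - k) * (q v / p)" by simp
      also have "\<dots> \<le> q v / p + d * (q v / p)"
      proof (intro add_mono mult_right_mono)
        show "q v \<le> q v / p" using q0[of v] p by (simp add: field_simps mult_left_le_one_le)
        have "card (nbrs G v - k) \<le> card (nbrs G v)" by (intro card_mono finite_nbrs) auto
        then show "real (card (nbrs G v - k)) \<le> d" using degree[OF vV] by linarith
      qed (use q0 p in auto)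
      also have "\<dots> = c * q v" by (simp add: c_def add_divide_distrib distrib_right)
      finally show "(\<Sum>z\<in>?A v. q z) \<le> c * q v" .
    qed
    also have "\<dots> = c * (\<Sum>v\<in>?Z. q v)" by (simp add: sum_distrib_left)
    also have "\<dots> \<le> c * (c ^ i * (\<Sum>(y, z)\<in>?B. q z))"
      using Suc c1 by (intro mult_left_mono) auto
    finally show ?case by (simp add: mult.assoc)
  qed
  have "(\<Sum>z\<in>nbhd G r k - k. q z) \<le> (\<Sum>(y, z)\<in>?B. m z)"
  proof (cases r)
    case 0
    then show ?thesis using m0 by (auto intro!: sum_nonneg)
  next
    case (Suc i)
    have Q0: "0 \<le> (\<Sum>(y, z)\<in>?B. q z)" using q0 by (auto intro!: sum_nonneg)
    have "(\<Sum>z\<in>nbhd G r k - k. q z) \<le> c ^ i * (\<Sum>(y, z)\<in>?B. q z)"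
      using far[of i] Suc by simp
    also have "\<dots> \<le> c ^ r * (\<Sum>(y, z)\<in>?B. q z)"
      using c1 Suc Q0 by (intro mult_right_mono power_increasing) auto
    also have "\<dots> \<le> N * (\<Sum>(y, z)\<in>?B. q z)"
      using r Q0 by (intro mult_right_mono) (auto simp: c_def)
    also have "\<dots> \<le> (\<Sum>(y, z)\<in>?B. m z)"
      unfolding sum_distrib_left using qm by (intro sum_mono) auto
    finally show ?thesis .
  qed
  then have "(\<Sum>z\<in>nbhd G r k - k. tailp G p N w) \<le> 2 * (\<Sum>(y, z)\<in>?B. m z)"
    using sum_mono[OF dich, of "nbhd G r k - k" "\<lambda>z. z"] small unfolding sum.distrib by simp
  then show ?thesis by (simp add: m_def mult.commute)
qed

end

section \<open>A finite-size criterion under vertex expansion\<close>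

context expander
begin

text \<open>
  Combine Russo's formula, the spatial Markov property for \<open>K\<close>, \<open>fresh_large_cluster\<close> and expansion.
  The truncation at \<open>(A + 1) * N\<close> leaves room for a gain of \<open>N\<close> from every cluster with at most \<open>A * N\<close>
  vertices, and the factor \<open>N * (\<theta>\<^sub>N - \<theta>\<^bsub>A N\<^esub>)\<close> is a lower bound for the mean size of \<open>K\<close> on the event
  that it has at most \<open>A * N\<close> vertices. All edges involved lie in \<open>E\<close>: such a \<open>K\<close> is within
  distance \<open>A * N\<close> of \<open>u\<close>, the vertices \<open>z\<close> are at most \<open>r\<close> further, and their clusters are decided
  within another \<open>N\<close>.
\<close>

lemma truncated_cluster_derivative:
  fixes A N r :: nat
  assumes p: "0 < p" "p \<le> 1" and A: "1 \<le> A" and N: "1 \<le> N" and r: "((1 + d) / p) ^ r \<le> N"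
    and u: "u \<in> verts G"
  defines "E \<equiv> edges_inside G (nbhd G (A * N + r + N + 1) {u})"
    and "f \<equiv> \<lambda>\<omega>. real (min (card (cluster \<omega> {u})) ((A + 1) * N))"
  shows "tailp G p N u / 2 * ((1 + lam) ^ r - 1) * N * (tailp G p N u - tailp G p (A * N) u) \<le>
    (\<Sum>e\<in>E. bexp (E - {e}) p (\<lambda>\<omega>. f (insert e \<omega>) - f \<omega>))"
proof -
  define K where "K \<omega> = cluster \<omega> {u}" for \<omega>
  define a where "a = tailp G p N u / 2 * ((1 + lam) ^ r - 1)"
  define F where "F k \<eta> = of_bool (card k \<le> A * N) *
    (\<Sum>(y, z)\<in>edge_boundary G k. real (min (card (cluster \<eta> {z})) N))" for k \<eta>
  have E: "finite E" "E \<subseteq> edges G"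
    unfolding E_def by (rule finite_ball_edges) (simp add: edges_inside_def)
  have finC: "finite (cluster \<omega> {z})" if "\<omega> \<subseteq> E" for \<omega> z
    using that E finite_subset by (intro finite_open_cluster) auto
  have mono: "f \<omega> \<le> f (insert e \<omega>)" if "\<omega> \<subseteq> E" "e \<in> E" for \<omega> e
    using card_cluster_mono[OF E that, of u] by (auto simp: f_def)
  have a0: "0 \<le> a"
    using tailp_nonneg[of p N u] p lam by (simp add: a_def)
  have KV: "K \<omega> \<subseteq> nbhd G (A * N) {u}" if "\<omega> \<subseteq> E" "card (K \<omega>) \<le> A * N" for \<omega>
    using that E finC unfolding K_def by (intro cluster_subset_nbhd) auto
  have "a * N * (tailp G p N u - tailp G p (A * N) u) =
      bexp E p (\<lambda>\<omega>. a * N * (of_bool (N \<le> card (K \<omega>)) - of_bool (A * N \<le> card (K \<omega>))))"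
  proof -
    have "edges_inside G (nbhd G M {u}) \<subseteq> E" if "M \<le> A * N" for M
      unfolding E_def using that nbhd_mono[of M "A * N + r + N + 1" "{u}" "{u}" G] by (intro edges_inside_mono) auto
    then show ?thesis
      using A tailp_eq[OF E, of N u p] tailp_eq[OF E, of "A * N" u p]
      by (simp add: bexp_cmult bexp_diff K_def)
  qed
  also have "\<dots> \<le> bexp E p (\<lambda>\<omega>. a * (of_bool (card (K \<omega>) \<le> A * N) * card (K \<omega>)))"
  proof (rule bexp_mono)
    fix \<omega>
    have "real N * (of_bool (N \<le> card (K \<omega>)) - of_bool (A * N \<le> card (K \<omega>))) \<le>
        of_bool (card (K \<omega>) \<le> A * N) * card (K \<omega>)"
      by auto
    from mult_left_mono[OF this a0]
    show "a * real N * (of_bool (N \<le> card (K \<omega>)) - of_bool (A * N \<le> card (K \<omega>))) \<le>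
        a * (of_bool (card (K \<omega>) \<le> A * N) * card (K \<omega>))"
      by (simp add: mult.assoc)
  qed (use p in auto)
  also have "\<dots> \<le> bexp E p (\<lambda>\<omega>. bexp (E - touching (K \<omega>)) p (F (K \<omega>)))"
  proof (rule bexp_mono)
    fix \<omega> assume \<omega>: "\<omega> \<subseteq> E"
    show "a * (of_bool (card (K \<omega>) \<le> A * N) * card (K \<omega>)) \<le> bexp (E - touching (K \<omega>)) p (F (K \<omega>))"
    proof (cases "card (K \<omega>) \<le> A * N")
      case True
      let ?k = "K \<omega>"
      note near = KV[OF \<omega> True]
      have k: "finite ?k" "?k \<subseteq> verts G"
        using near nbhd_verts[of "{u}"] u finC[OF \<omega>] by (auto simp: K_def)
      have sub: "edges_inside G (nbhd G N {z}) \<subseteq> E" if z: "z \<in> nbhd G r ?k" for z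
      proof -
        have "z \<in> nbhd G (r + A * N) {u}"
          using z nbhd_mono[OF order_refl near, of G r] by (auto simp: nbhd_add)
        then have "nbhd G N {z} \<subseteq> nbhd G (N + (r + A * N)) {u}"
          using nbhd_mono[of N N "{z}" "nbhd G (r + A * N) {u}" G] by (simp add: nbhd_add)
        also have "\<dots> \<subseteq> nbhd G (A * N + r + N + 1) {u}"
          by (rule nbhd_mono) auto
        finally show ?thesis unfolding E_def by (rule edges_inside_mono)
      qed
      have "(1 + lam) ^ r * card ?k \<le> card (nbhd G r ?k)"
        by (rule expansion_iterated[OF k])
      also have "\<dots> = card (nbhd G r ?k - ?k) + card ?k"
        using card_Diff_subset[OF k(1) nbhd_self[of ?k G r]]
          card_mono[OF finite_nbhd[OF k(1)] nbhd_self[of ?k G r]] by simp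
      finally have grow: "((1 + lam) ^ r - 1) * card ?k \<le> card (nbhd G r ?k - ?k)"
        by (simp add: algebra_simps)
      have "a * card ?k \<le> tailp G p N u / 2 * card (nbhd G r ?k - ?k)"
        using mult_left_mono[OF grow, of "tailp G p N u / 2"] tailp_nonneg[of p N u] p
        by (simp add: a_def mult.assoc)
      also have "\<dots> \<le> (\<Sum>(y, z)\<in>edge_boundary G ?k.
          bexp (E - touching ?k) p (\<lambda>\<eta>. real (min (card (cluster \<eta> {z})) N)))"
        using fresh_large_cluster[OF k E sub p N r u] by simp
      also have "\<dots> = bexp (E - touching ?k) p (F ?k)"
        using True by (simp add: F_def[abs_def] bexp_sum case_prod_unfold)
      finally show ?thesis using True by simp
    next
      case False
      then show ?thesis
        using p by (auto simp: F_def[abs_def] intro!: bexp_nonneg sum_nonneg)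
    qed
  qed (use p in auto)
  also have "\<dots> = bexp E p (\<lambda>\<omega>. F (K \<omega>) (\<omega> - touching (K \<omega>)))"
    unfolding K_def by (rule bexp_cluster_Markov[OF E(1), symmetric])
  also have "\<dots> \<le> bexp E p (\<lambda>\<omega>. \<Sum>e\<in>E. f (insert e \<omega>) - f \<omega>)"
  proof (rule bexp_mono)
    fix \<omega> assume \<omega>: "\<omega> \<subseteq> E"
    let ?k = "K \<omega>"
    show "F ?k (\<omega> - touching ?k) \<le> (\<Sum>e\<in>E. f (insert e \<omega>) - f \<omega>)"
    proof (cases "card ?k \<le> A * N")
      case True
      let ?B = "edge_boundary G ?k"
      note near = KV[OF \<omega> True]
      have fink: "finite ?k" using finC[OF \<omega>] by (simp add: K_def)
      have BE: "{y, z} \<in> E" if "(y, z) \<in> ?B" for y z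
      proof -
        have "y \<in> nbhd G (A * N) {u}" using that near by (auto simp: edge_boundary_def)
        then have "{y, z} \<subseteq> nbhd G (Suc (A * N)) {u}"
          using that nbhd_step[of y G "A * N" "{u}" z] by (auto simp: edge_boundary_def)
        also have "\<dots> \<subseteq> nbhd G (A * N + r + N + 1) {u}"
          by (rule nbhd_mono) auto
        finally show ?thesis using that by (simp add: E_def edges_inside_def edge_boundary_def)
      qed
      have inj: "inj_on (\<lambda>(y, z). {y, z}) ?B"
        by (auto simp: inj_on_def edge_boundary_def doubleton_eq_iff)
      have gain: "real (min (card (cluster (\<omega> - touching ?k) {z})) N) \<le> f (insert {y, z} \<omega>) - f \<omega>"
        if B: "(y, z) \<in> ?B" for y z
      proof -
        let ?C = "cluster (\<omega> - touching ?k) {z}"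
        have yz: "y \<in> cluster \<omega> {u}" "z \<notin> cluster \<omega> {u}"
          using B by (auto simp: edge_boundary_def K_def)
        have "?C \<inter> ?k = {}"
          using yz by (intro cluster_off_disjoint) (auto simp: K_def)
        moreover have "finite ?C" using \<omega> by (intro finC) auto
        ultimately have "card ?k + card ?C = card (?k \<union> ?C)"
          using fink by (subst card_Un_disjoint) auto
        also have "\<dots> \<le> card (cluster (insert {y, z} \<omega>) {u})"
          using cluster_attach[OF yz] BE[OF B] \<omega> by (intro card_mono finC) (auto simp: K_def)
        finally have "card ?k + card ?C \<le> card (cluster (insert {y, z} \<omega>) {u})" .
        then have "min (card ?k) ((A + 1) * N) + min (card ?C) N \<le>
            min (card (cluster (insert {y, z} \<omega>) {u})) ((A + 1) * N)"
          using True by (auto simp: algebra_simps)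
        then show ?thesis unfolding f_def K_def[symmetric] by linarith
      qed
      have "F ?k (\<omega> - touching ?k) = (\<Sum>(y, z)\<in>?B. real (min (card (cluster (\<omega> - touching ?k) {z})) N))"
        using True by (simp add: F_def)
      also have "\<dots> \<le> (\<Sum>b\<in>?B. f (insert (case b of (y, z) \<Rightarrow> {y, z}) \<omega>) - f \<omega>)"
        using gain by (intro sum_mono) auto
      also have "\<dots> = (\<Sum>e\<in>(\<lambda>(y, z). {y, z}) ` ?B. f (insert e \<omega>) - f \<omega>)"
        by (subst sum.reindex[OF inj]) simp
      also have "\<dots> \<le> (\<Sum>e\<in>E. f (insert e \<omega>) - f \<omega>)"
        using E(1) BE mono[OF \<omega>] by (intro sum_mono2) auto
      finally show ?thesis .
    next
      case False
      then show ?thesis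
        using mono[OF \<omega>] by (auto simp: F_def intro!: sum_nonneg)
    qed
  qed (use p in auto)
  also have "\<dots> \<le> (\<Sum>e\<in>E. bexp (E - {e}) p (\<lambda>\<omega>. f (insert e \<omega>) - f \<omega>))"
    using E p mono by (intro bexp_derivative_ge) auto
  finally show ?thesis by (simp add: a_def)
qed

text \<open>
  The truncated mean is at most \<open>(A + 1) * N\<close>, so its derivative cannot be large throughout
  \<open>[p, q]\<close>. At a point where it is not, clusters of size between \<open>N\<close> and \<open>A * N\<close> are rare, so that
  \<open>\<theta>\<^sub>N\<close> and \<open>\<theta>\<^bsub>A N\<^esub>\<close> are close there; monotonicity in the parameter transfers this to \<open>p\<close> and \<open>q\<close>.
\<close>

lemma tail_next_scale:
  fixes A N r :: nat
  assumes p: "0 < p" "p < q" "q \<le> 1" and A: "1 \<le> A" and N: "1 \<le> N"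
    and r: "1 \<le> r" "((1 + d) / p) ^ r \<le> N" and u: "u \<in> verts G"
    and t: "0 < t" "t \<le> tailp G p N u"
  shows "tailp G p N u - 2 * (A + 1) / ((q - p) * t * ((1 + lam) ^ r - 1)) \<le> tailp G q (A * N) u"
proof -
  let ?E = "edges_inside G (nbhd G (A * N + r + N + 1) {u})"
  let ?f = "\<lambda>\<omega>. real (min (card (cluster \<omega> {u})) ((A + 1) * N))"
  let ?D = "\<lambda>x. \<Sum>e\<in>?E. bexp (?E - {e}) x (\<lambda>\<omega>. ?f (insert e \<omega>) - ?f \<omega>)"
  define L where "L = (1 + lam) ^ r - 1"
  have "1 < (1 + lam) ^ r" using lam r by (intro one_less_power) auto
  then have L: "0 < L" by (simp add: L_def)
  obtain x where x: "p < x" "x < q" and mvt: "bexp ?E q ?f - bexp ?E p ?f = (q - p) * ?D x"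
    using MVT2[OF p(2), of "\<lambda>x. bexp ?E x ?f" ?D] bexp_has_derivative[OF finite_ball_edges] by blast
  have x01: "0 < x" "x \<le> 1" using x p by auto
  let ?\<Delta> = "tailp G x N u - tailp G x (A * N) u"
  have "((1 + d) / x) ^ r \<le> ((1 + d) / p) ^ r"
    using x p by (intro power_mono divide_left_mono) auto
  then have rx: "((1 + d) / x) ^ r \<le> N" using r by linarith
  have tx: "tailp G p N u \<le> tailp G x N u" "tailp G x (A * N) u \<le> tailp G q (A * N) u"
    using x p by (auto intro: tailp_mono)
  have D0: "0 \<le> ?\<Delta>"
    using A x01 tailp_antimono[of x N "A * N" u] by simp
  have "(q - p) * (t / 2 * L * N * ?\<Delta>) \<le> (q - p) * (tailp G x N u / 2 * L * N * ?\<Delta>)"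
    using t tx L D0 p by (intro mult_left_mono mult_right_mono) auto
  also have "\<dots> \<le> (q - p) * ?D x"
    using p truncated_cluster_derivative[OF x01 A N rx u] by (intro mult_left_mono) (auto simp: L_def)
  also have "\<dots> \<le> bexp ?E q ?f"
    using mvt bexp_nonneg[of p ?E ?f] p by simp
  also have "\<dots> \<le> real ((A + 1) * N)"
  proof (rule bexp_le_const[OF finite_ball_edges])
    show "?f \<omega> \<le> real ((A + 1) * N)" for \<omega>
      by (rule of_nat_mono) simp
  qed (use p in auto)
  finally have "(q - p) * (t / 2 * L * N * ?\<Delta>) \<le> real (A + 1) * N" by (simp only: of_nat_mult)
  moreover have eq: "(q - p) * (t / 2 * L * N * x) = (q - p) * t * L * x * N / 2" for x
    by simp
  note eq[of ?\<Delta>]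
  ultimately have "(q - p) * t * L * ?\<Delta> * N \<le> 2 * real (A + 1) * N" by linarith
  then have "(q - p) * t * L * ?\<Delta> \<le> 2 * (A + 1)" using N by simp
  moreover have "0 < (q - p) * t * L" using p t L by simp
  ultimately have "?\<Delta> \<le> 2 * (A + 1) / ((q - p) * t * L)"
    by (simp add: pos_le_divide_eq mult.commute)
  then show ?thesis using tx by (simp add: L_def)
qed

text \<open>
  The finite-size criterion. Scale \<open>i\<close> has size \<open>A^i\<close> and uses radius \<open>i\<close>, which is the largest radius that
  the condition in \<open>tail_next_scale\<close> allows, up to the choice of \<open>A\<close>. The parameter is raised by \<open>\<epsilon> i\<close> to
  pass from scale \<open>i\<close> to the next.
\<close>

lemma tail_all_scales:
  fixes A :: nat and \<epsilon> :: "nat \<Rightarrow> real"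
  assumes p: "0 < p" "p \<le> q" "q \<le> 1" and A: "(1 + d) / p \<le> A" and u: "u \<in> verts G" and m: "1 \<le> m"
    and \<epsilon>: "\<And>i. 0 < \<epsilon> i" "\<And>j. sum \<epsilon> {m..<j} \<le> q - p"
    and t: "0 < t" "2 * t \<le> tailp G p (A ^ m) u"
    and loss: "\<And>j. (\<Sum>i = m..<j. 2 * (A + 1) / (\<epsilon> i * t * ((1 + lam) ^ i - 1))) \<le> t"
    and j: "m \<le> j"
  shows "t \<le> tailp G q (A ^ j) u"
proof -
  let ?l = "\<lambda>i. 2 * (A + 1) / (\<epsilon> i * t * ((1 + lam) ^ i - 1))"
  have A1: "1 \<le> A"
  proof -
    have "1 \<le> (1 + real d) / p" using p by (simp add: field_simps)
    then show ?thesis using A by simp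
  qed
  have "2 * t - sum ?l {m..<j} \<le> tailp G (p + sum \<epsilon> {m..<j}) (A ^ j) u"
    using j
  proof (induction j rule: dec_induct)
    case (step j)
    let ?p = "p + sum \<epsilon> {m..<j}"
    have s0: "0 \<le> sum \<epsilon> {m..<j}" using \<epsilon>(1) by (intro sum_nonneg) (auto simp: less_imp_le)
    have q: "?p + \<epsilon> j \<le> 1" using \<epsilon>(2)[of "Suc j"] step p by simp
    have "((1 + d) / ?p) ^ j \<le> ((1 + d) / p) ^ j"
      using p s0 by (intro power_mono divide_left_mono) (auto intro!: mult_pos_pos add_pos_nonneg)
    also have "\<dots> \<le> real A ^ j" using A p by (intro power_mono) auto
    finally have r: "((1 + d) / ?p) ^ j \<le> (A ^ j :: nat)" by simp
    have "t \<le> tailp G ?p (A ^ j) u"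
      using step loss[of j] by linarith
    then have "tailp G ?p (A ^ j) u - ?l j \<le> tailp G (?p + \<epsilon> j) (A * A ^ j) u"
      using tail_next_scale[of ?p "?p + \<epsilon> j" A "A ^ j" j u t] p s0 q \<epsilon>(1)[of j] A1 m step r u t(1) by simp
    then show ?case using step by (simp add: add.assoc)
  qed (use t in simp)
  moreover have "tailp G (p + sum \<epsilon> {m..<j}) (A ^ j) u \<le> tailp G q (A ^ j) u"
    using p \<epsilon>(2)[of j] \<epsilon>(1) by (intro tailp_mono) (auto intro!: add_nonneg_nonneg sum_nonneg simp: less_imp_le)
  ultimately show ?thesis using loss[of j] by linarith
qed

end

text \<open>
  The losses are controlled by \<open>1 / (\<epsilon> i * (1 + lam)^i)\<close>. With increments that decay like \<open>(1 + lam)^(-i/2)\<close>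
  both the increments and the losses are geometric, so from some scale on the losses sum to at most \<open>t\<close>.
\<close>

lemma sprinkling_schedule:
  fixes lam t c \<delta> :: real
  assumes "0 < lam" "0 < t" "0 < \<delta>" "0 \<le> c"
  obtains \<epsilon> :: "nat \<Rightarrow> real" and m :: nat where "\<And>i. 0 < \<epsilon> i" "1 \<le> m" "\<And>j. sum \<epsilon> {m..<j} \<le> \<delta>"
    "\<And>j. (\<Sum>i = m..<j. c / (\<epsilon> i * t * ((1 + lam) ^ i - 1))) \<le> t"
proof -
  define b where "b = 1 / sqrt (1 + lam)"
  have b: "0 < b" "b < 1" "b * b * (1 + lam) = 1"
    using assms(1) by (auto simp: b_def field_simps)
  define \<epsilon> where "\<epsilon> i = \<delta> * (1 - b) * b ^ i" for i :: nat
  have \<epsilon>: "0 < \<epsilon> i" for i using b assms by (simp add: \<epsilon>_def)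
  have sum\<epsilon>: "sum \<epsilon> {m..<j} \<le> \<delta>" for m j
  proof -
    have "sum \<epsilon> {m..<j} \<le> sum \<epsilon> {..<j}"
      using \<epsilon> by (intro sum_mono2) (auto simp: less_imp_le)
    also have "\<dots> = \<delta> * ((1 - b) * (\<Sum>i<j. b ^ i))"
      by (simp add: \<epsilon>_def sum_distrib_left mult.assoc)
    also have "\<dots> = \<delta> * (1 - b ^ j)"
      by (simp add: one_diff_power_eq)
    also have "\<dots> \<le> \<delta>" using assms b by (simp add: mult_left_le)
    finally show ?thesis .
  qed
  let ?l = "\<lambda>i. c / (\<epsilon> i * t * ((1 + lam) ^ i - 1))"
  define c' where "c' = c * (1 + lam) / (\<delta> * (1 - b) * t * lam)"
  have l: "0 \<le> ?l i" "?l i \<le> c' * b ^ i" if i: "1 \<le> i" for i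
  proof -
    have one: "1 < (1 + lam) ^ i" using assms i by (intro one_less_power) auto
    then show "0 \<le> ?l i" using \<epsilon>[of i] assms by simp
    obtain k where k: "i = Suc k" using i by (cases i) auto
    have "lam / (1 + lam) * (1 + lam) ^ i = lam * (1 + lam) ^ k"
      using assms k by simp
    also have "\<dots> \<le> (1 + lam) ^ i - 1"
      using one_le_power[of "1 + lam" k] assms k by (simp add: algebra_simps)
    finally have "\<epsilon> i * t * (lam / (1 + lam) * (1 + lam) ^ i) \<le> \<epsilon> i * t * ((1 + lam) ^ i - 1)"
      using \<epsilon>[of i] assms by (intro mult_left_mono) auto
    then have "?l i \<le> c / (\<epsilon> i * t * (lam / (1 + lam) * (1 + lam) ^ i))"
      using \<epsilon>[of i] assms one by (intro divide_left_mono) auto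
    also have "\<dots> = c' / (b ^ i * (1 + lam) ^ i)"
      using b assms by (simp add: \<epsilon>_def c'_def field_simps)
    also have "b ^ i * (1 + lam) ^ i = inverse (b ^ i)"
    proof -
      have "b ^ i * (b ^ i * (1 + lam) ^ i) = 1"
        unfolding mult.assoc[symmetric] power_mult_distrib[symmetric] by (simp add: b)
      then show ?thesis using inverse_unique by metis
    qed
    finally show "?l i \<le> c' * b ^ i" by (simp add: field_simps)
  qed
  have "summable ?l"
  proof (rule summable_comparison_test')
    show "summable (\<lambda>i. c' * b ^ i)" using b by (intro summable_mult summable_geometric) auto
    show "norm (?l i) \<le> c' * b ^ i" if "1 \<le> i" for i
      using l[OF that] by (simp only: real_norm_def abs_of_nonneg)
  qed
  then obtain M where M: "\<And>m n. M \<le> m \<Longrightarrow> norm (sum ?l {m..<n}) < t"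
    using assms(2) unfolding summable_Cauchy by blast
  show thesis
  proof (rule that[of \<epsilon> "Suc M"])
    show "(\<Sum>i = Suc M..<j. ?l i) \<le> t" for j
      using M[of "Suc M" j] by simp
  qed (use \<epsilon> sum\<epsilon> in auto)
qed

section \<open>A mean-field lower bound above criticality\<close>

context homogeneous_graph
begin

text \<open>
  The expectation is that of the number of edges leading out of \<open>S\<close> whose inner endpoint is joined to \<open>u\<close>
  inside \<open>S\<close>; call it \<open>\<phi>\<close>. If the cluster of \<open>u\<close> is much larger than \<open>S\<close>, then beyond one of these edges
  there is a large cluster that avoids the part \<open>C\<close> of the cluster explored inside \<open>S\<close>. Conditionally on
  \<open>C\<close> this has probability at most \<open>\<theta>\<^sub>M\<close>. Hence \<open>\<beta> \<le> \<phi> * \<beta>\<close> for the limit \<open>\<beta>\<close> of \<open>\<theta>\<^sub>M\<close>, which is positive.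
\<close>

lemma percolating_boundary:
  assumes p: "0 \<le> p" "p \<le> 1" and u: "u \<in> verts G"
    and t: "0 < t" "\<And>M. t \<le> tailp G p M u"
    and S: "finite S" "S \<subseteq> verts G" "u \<in> S"
  shows "1 \<le> bexp (edges_inside G S) p
    (\<lambda>\<eta>. real (card {(x, y) \<in> edge_boundary G S. x \<in> cluster \<eta> {u}}))"
proof -
  let ?B = "edge_boundary G S" and ?I = "edges_inside G S"
  define \<phi> where "\<phi> = bexp ?I p (\<lambda>\<eta>. real (card {(x, y) \<in> ?B. x \<in> cluster \<eta> {u}}))"
  define \<beta> where "\<beta> = (INF M. tailp G p M u)"
  have bdd: "bdd_below (range (\<lambda>M. tailp G p M u))"
    using t by (intro bdd_belowI2)
  have finB: "finite ?B" using S(1) by (rule finite_edge_boundary)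
  have "\<beta> \<le> \<phi> * tailp G p M u" for M
  proof -
    \<comment> \<open>more vertices than \<open>S\<close> and \<open>card ?B\<close> clusters of size at most \<open>M\<close> can hold\<close>
    define N where "N = card S + card ?B * M + 1"
    define W where "W = nbhd G N {u} \<union> (\<Union>(x, y)\<in>?B. nbhd G M {y}) \<union> S"
    define E where "E = edges_inside G W"
    define C where "C \<omega> = cluster (\<omega> \<inter> ?I) {u}" for \<omega>
    define F where "F c \<eta> = (\<Sum>(x, y)\<in>?B. of_bool (x \<in> c) * of_bool (M \<le> card (cluster \<eta> {y})) :: real)" for c \<eta>
    have "finite W" using finB S by (auto simp: W_def intro!: finite_nbhd)
    then have E: "finite E" "E \<subseteq> edges G"
      unfolding E_def by (rule finite_edges_inside) (simp add: edges_inside_def)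
    have IE: "?I \<subseteq> E" unfolding E_def by (rule edges_inside_mono) (auto simp: W_def)
    have finC: "finite (cluster \<omega> {z})" if "\<omega> \<subseteq> E" for \<omega> z
      using that E finite_subset by (intro finite_open_cluster) auto
    have CS: "C \<omega> \<subseteq> S" for \<omega>
      using cluster_subset[of "\<omega> \<inter> ?I" "{u}"] S by (auto simp: C_def edges_inside_def)
    have "\<beta> \<le> tailp G p N u" unfolding \<beta>_def using bdd by (intro cINF_lower) auto
    also have "\<dots> = bexp E p (\<lambda>\<omega>. of_bool (N \<le> card (cluster \<omega> {u})))"
      by (rule tailp_eq[OF E, symmetric]) (auto simp: E_def W_def intro!: edges_inside_mono)
    also have "\<dots> \<le> bexp E p (\<lambda>\<omega>. F (C \<omega>) (\<omega> - touching (C \<omega>)))"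
    proof (rule bexp_mono[OF p])
      fix \<omega> assume \<omega>: "\<omega> \<subseteq> E"
      let ?C = "C \<omega>"
      let ?\<eta> = "\<omega> - touching ?C"
      have F0: "0 \<le> F ?C ?\<eta>" unfolding F_def by (intro sum_nonneg) auto
      show "of_bool (N \<le> card (cluster \<omega> {u})) \<le> F ?C ?\<eta>"
      proof (cases "\<exists>(x, y)\<in>?B. x \<in> ?C \<and> M \<le> card (cluster ?\<eta> {y})")
        case True
        then obtain x y where xy: "(x, y) \<in> ?B" "x \<in> ?C" "M \<le> card (cluster ?\<eta> {y})" by blast
        have "of_bool (x \<in> ?C) * of_bool (M \<le> card (cluster ?\<eta> {y})) \<le> F ?C ?\<eta>"
          unfolding F_def
          using member_le_sum[of "(x, y)" ?B "\<lambda>(x, y). of_bool (x \<in> ?C) * of_bool (M \<le> card (cluster ?\<eta> {y})) :: real"]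
            finB xy(1) by auto
        then show ?thesis using xy by auto
      next
        case False
        define B' where "B' = {b \<in> ?B. fst b \<in> ?C}"
        have small: "card (cluster ?\<eta> {snd b}) \<le> M" if "b \<in> B'" for b
          using False that by (force simp: B'_def)
        let ?D = "S \<union> (\<Union>b\<in>B'. cluster ?\<eta> {snd b})"
        have finB': "finite B'" "card B' \<le> card ?B"
          using finB by (auto simp: B'_def intro: card_mono)
        have "cluster \<omega> {u} \<subseteq> ?C \<union> (\<Union>b\<in>B'. cluster ?\<eta> {snd b})"
        proof (rule cluster_least)
          show "{u} \<subseteq> ?C \<union> (\<Union>b\<in>B'. cluster ?\<eta> {snd b})" by (simp add: C_def)
          fix a b assume a: "a \<in> ?C \<union> (\<Union>b\<in>B'. cluster ?\<eta> {snd b})" and ab: "{a, b} \<in> \<omega>"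
          have abG: "{a, b} \<in> edges G" using ab \<omega> E by blast
          show "b \<in> ?C \<union> (\<Union>b\<in>B'. cluster ?\<eta> {snd b})"
          proof (cases "a \<in> ?C")
            case aC: True
            show ?thesis
            proof (cases "b \<in> S")
              case True
              then have "{a, b} \<in> \<omega> \<inter> ?I"
                using aC CS[of \<omega>] ab abG by (auto simp: edges_inside_def)
              then have "b \<in> ?C" using aC unfolding C_def by (rule cluster_step[rotated])
              then show ?thesis by simp
            next
              case False
              then have "(a, b) \<in> B'"
                using aC CS[of \<omega>] abG by (auto simp: B'_def edge_boundary_def)
              then show ?thesis by force
            qed
          next
            case aC: False
            then obtain e where e: "e \<in> B'" "a \<in> cluster ?\<eta> {snd e}" using a by blast
            show ?thesis
            proof (cases "b \<in> ?C")
              case False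
              then have "{a, b} \<in> ?\<eta>" using aC ab by (auto simp: touching_def)
              then have "b \<in> cluster ?\<eta> {snd e}" by (rule cluster_step[OF e(2)])
              then show ?thesis using e by blast
            qed simp
          qed
        qed
        also have "\<dots> \<subseteq> ?D" using CS[of \<omega>] by blast
        finally have sub: "cluster \<omega> {u} \<subseteq> ?D" .
        have finD: "finite ?D" using S finB' \<omega> by (auto intro!: finC)
        have "card (cluster \<omega> {u}) \<le> card ?D" by (rule card_mono[OF finD sub])
        also have "\<dots> \<le> card S + card (\<Union>b\<in>B'. cluster ?\<eta> {snd b})" by (rule card_Un_le)
        also have "\<dots> \<le> card S + (\<Sum>b\<in>B'. card (cluster ?\<eta> {snd b}))"
          using finB' by (intro add_left_mono card_UN_le)
        also have "\<dots> \<le> card S + (\<Sum>b\<in>B'. M)"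
          using small by (intro add_left_mono sum_mono)
        also have "\<dots> \<le> card S + card ?B * M" using finB' by simp
        also have "\<dots> < N" by (simp add: N_def)
        finally show ?thesis using F0 by simp
      qed
    qed
    also have "\<dots> = bexp E p (\<lambda>\<omega>. bexp (E - touching (C \<omega>)) p (F (C \<omega>)))"
    proof (rule bexp_spatial_Markov[OF E(1)])
      fix \<omega> \<omega>' assume "\<omega> \<inter> touching (C \<omega>) = \<omega>' \<inter> touching (C \<omega>)"
      then show "C \<omega>' = C \<omega>"
        unfolding C_def by (intro cluster_stopping) blast
    qed
    also have "\<dots> \<le> bexp E p (\<lambda>\<omega>. tailp G p M u * card {(x, y) \<in> ?B. x \<in> C \<omega>})"
    proof (rule bexp_mono[OF p])
      fix \<omega> assume \<omega>: "\<omega> \<subseteq> E"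
      let ?T = "touching (C \<omega>)"
      have y: "bexp (E - ?T) p (\<lambda>\<eta>. of_bool (M \<le> card (cluster \<eta> {y}))) \<le> tailp G p M u"
        if "(x, y) \<in> ?B" for x y
      proof -
        have yV: "y \<in> verts G" using that by (auto simp: edge_boundary_def dest: edge_verts)
        have "bexp (E - ?T) p (\<lambda>\<eta>. of_bool (M \<le> card (cluster \<eta> {y}))) =
            bexp E p (\<lambda>\<omega>. of_bool (M \<le> card (cluster (\<omega> - ?T) {y})))"
          by (rule bexp_minus[OF E(1), symmetric])
        also have "\<dots> \<le> bexp E p (\<lambda>\<omega>. of_bool (M \<le> card (cluster \<omega> {y})))"
        proof (rule bexp_mono[OF p])
          fix \<omega> assume "\<omega> \<subseteq> E"
          then have "card (cluster (\<omega> - ?T) {y}) \<le> card (cluster \<omega> {y})"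
            by (intro card_mono finC cluster_mono) auto
          then show "of_bool (M \<le> card (cluster (\<omega> - ?T) {y})) \<le> (of_bool (M \<le> card (cluster \<omega> {y})) :: real)"
            by auto
        qed
        also have "\<dots> = tailp G p M y"
          using that by (intro tailp_eq[OF E]) (auto simp: E_def W_def intro!: edges_inside_mono)
        also have "\<dots> = tailp G p M u" by (rule homogeneous[OF yV u])
        finally show ?thesis .
      qed
      have "bexp (E - ?T) p (F (C \<omega>)) =
          (\<Sum>(x, y)\<in>?B. of_bool (x \<in> C \<omega>) * bexp (E - ?T) p (\<lambda>\<eta>. of_bool (M \<le> card (cluster \<eta> {y}))))"
        by (simp add: F_def[abs_def] bexp_sum case_prod_unfold bexp_cmult)
      also have "\<dots> \<le> (\<Sum>(x, y)\<in>?B. of_bool (x \<in> C \<omega>) * tailp G p M u)"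
        using y by (intro sum_mono) (auto intro!: mult_left_mono)
      also have "\<dots> = tailp G p M u * (\<Sum>b\<in>?B. of_bool (fst b \<in> C \<omega>))"
        by (simp add: sum_distrib_left case_prod_unfold mult.commute)
      also have "(\<Sum>b\<in>?B. of_bool (fst b \<in> C \<omega>) :: real) = card {(x, y) \<in> ?B. x \<in> C \<omega>}"
        using finB by (simp add: of_bool_def sum.If_cases Int_def case_prod_unfold)
      finally show "bexp (E - ?T) p (F (C \<omega>)) \<le> tailp G p M u * card {(x, y) \<in> ?B. x \<in> C \<omega>}" .
    qed
    also have "\<dots> = \<phi> * tailp G p M u"
      unfolding bexp_cmult C_def \<phi>_def
      using bexp_marginal[OF E(1) IE, of p "\<lambda>\<eta>. real (card {(x, y) \<in> ?B. x \<in> cluster \<eta> {u}})"] by simp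
    finally show ?thesis .
  qed
  note le = this
  have "t \<le> \<beta>" unfolding \<beta>_def using t by (intro cINF_greatest) auto
  then have \<beta>: "0 < \<beta>" using t by simp
  have "0 \<le> \<phi>" unfolding \<phi>_def using p by (intro bexp_nonneg) auto
  then have \<phi>: "0 < \<phi>" using le[of 0] \<beta> by (cases "\<phi> = 0") auto
  have "\<beta> / \<phi> \<le> tailp G p M u" for M
    using le[of M] \<phi> by (simp add: pos_divide_le_eq mult.commute)
  then have "\<beta> / \<phi> \<le> (INF M. tailp G p M u)"
    by (intro cINF_greatest) auto
  then have "\<beta> / \<phi> \<le> \<beta>" by (simp only: \<beta>_def)
  then have "1 \<le> \<phi>" using \<beta> \<phi> by (simp add: field_simps)
  then show ?thesis by (simp add: \<phi>_def)
qed

text \<open>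
  Let \<open>f\<close> indicate that \<open>u\<close> is joined to the outside of the ball \<open>\<Lambda>\<close>, and let \<open>K\<close> be the set of vertices so
  joined. Exploring \<open>K\<close> from outside leaves the edges inside the complement \<open>S\<close> of \<open>K\<close> fresh. If \<open>u \<in> S\<close>,
  every edge between \<open>S\<close> and \<open>K\<close> whose endpoint in \<open>S\<close> is joined to \<open>u\<close> inside \<open>S\<close> is pivotal, and by
  \<open>percolating_boundary\<close> there is at least one such edge on average. So the derivative of \<open>bexp E x f\<close> in
  \<open>x\<close> is at least \<open>1 - bexp E x f\<close>, and integration from \<open>p\<close> to \<open>q\<close> gives the claim.
\<close>

lemma percolating_mean_field:
  assumes p: "0 < p" "p < q" "q \<le> 1" and u: "u \<in> verts G"
    and t: "0 < t" "\<And>M. t \<le> tailp G p M u"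
  shows "(q - p) / (1 + (q - p)) \<le> tailp G q N u"
proof -
  define \<Lambda> where "\<Lambda> = nbhd G N {u}"
  define E where "E = edges_inside G (nbhd G (Suc N) {u})"
  define K where "K \<omega> = cluster \<omega> (- \<Lambda>)" for \<omega>
  define f where "f \<omega> = (of_bool (u \<in> K \<omega>) :: real)" for \<omega>
  define F where "F k \<eta> = of_bool (u \<notin> k) * real (card {(a, b) \<in> edge_boundary G (- k). a \<in> cluster \<eta> {u}})" for k \<eta>
  let ?D = "\<lambda>x. \<Sum>e\<in>E. bexp (E - {e}) x (\<lambda>\<omega>. f (insert e \<omega>) - f \<omega>)"
  have E: "finite E" "E \<subseteq> edges G"
    unfolding E_def by (rule finite_ball_edges) (simp add: edges_inside_def)
  have \<Lambda>: "finite \<Lambda>" "\<Lambda> \<subseteq> verts G"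
    unfolding \<Lambda>_def by (rule finite_nbhd, simp) (rule nbhd_verts, simp add: u)
  have touch: "{a, b} \<in> E" if "{a, b} \<in> edges G" "a \<in> \<Lambda>" for a b
    using that nbhd_step[of a G N "{u}" b] by (auto simp: E_def \<Lambda>_def edges_inside_def)
  have mono: "f \<omega> \<le> f (insert e \<omega>)" for \<omega> e
    using cluster_mono[of \<omega> "insert e \<omega>" "- \<Lambda>" "- \<Lambda>"] by (auto simp: f_def K_def)
  have outside: "- K \<omega> \<subseteq> \<Lambda>" for \<omega>
    using cluster_start[of "- \<Lambda>" \<omega>] by (auto simp: K_def)
  have deriv: "1 - bexp E x f \<le> ?D x" if x: "p < x" "x < q" for x
  proof -
    have x01: "0 \<le> x" "x \<le> 1" using x p by auto
    have tx: "t \<le> tailp G x M u" for M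
      using t(2)[of M] tailp_mono[of p x M u] x p by simp
    have "1 - bexp E x f = bexp E x (\<lambda>\<omega>. 1 - f \<omega>)"
      using E by (simp add: bexp_diff)
    also have "\<dots> \<le> bexp E x (\<lambda>\<omega>. bexp (E - touching (K \<omega>)) x (F (K \<omega>)))"
    proof (rule bexp_mono[OF x01])
      fix \<omega>
      show "1 - f \<omega> \<le> bexp (E - touching (K \<omega>)) x (F (K \<omega>))"
      proof (cases "u \<in> K \<omega>")
        case True
        then show ?thesis using E by (simp add: f_def F_def[abs_def])
      next
        case False
        let ?S = "- K \<omega>"
        have S: "finite ?S" "?S \<subseteq> verts G" "u \<in> ?S"
          using outside[of \<omega>] \<Lambda> False finite_subset by auto
        have "E - touching (K \<omega>) = edges_inside G ?S"
        proof
          show "edges_inside G ?S \<subseteq> E - touching (K \<omega>)"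
          proof
            fix e assume e: "e \<in> edges_inside G ?S"
            then obtain a b where ab: "e = {a, b}" by (auto simp: edges_inside_def elim: edgeE)
            have "e \<in> E"
              using e outside[of \<omega>] touch[of a b] by (auto simp: ab edges_inside_def)
            then show "e \<in> E - touching (K \<omega>)"
              using e by (auto simp: edges_inside_def touching_def)
          qed
        qed (use E in \<open>auto simp: edges_inside_def touching_def\<close>)
        then show ?thesis
          using percolating_boundary[OF x01 u t(1) tx S] False by (simp add: F_def[abs_def] f_def)
      qed
    qed
    also have "\<dots> = bexp E x (\<lambda>\<omega>. F (K \<omega>) (\<omega> - touching (K \<omega>)))"
      unfolding K_def by (rule bexp_cluster_Markov[OF E(1), symmetric])
    also have "\<dots> \<le> bexp E x (\<lambda>\<omega>. \<Sum>e\<in>E. f (insert e \<omega>) - f \<omega>)"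
    proof (rule bexp_mono[OF x01])
      fix \<omega> assume \<omega>: "\<omega> \<subseteq> E"
      have nonneg: "0 \<le> (\<Sum>e\<in>E. f (insert e \<omega>) - f \<omega>)"
        using mono by (intro sum_nonneg) auto
      show "F (K \<omega>) (\<omega> - touching (K \<omega>)) \<le> (\<Sum>e\<in>E. f (insert e \<omega>) - f \<omega>)"
      proof (cases "u \<in> K \<omega>")
        case True
        then show ?thesis using nonneg by (simp add: F_def)
      next
        case False
        let ?\<eta> = "\<omega> - touching (K \<omega>)"
        let ?B = "{(a, b) \<in> edge_boundary G (- K \<omega>). a \<in> cluster ?\<eta> {u}}"
        have inj: "inj_on (\<lambda>(a, b). {a, b}) ?B"
          by (auto simp: inj_on_def edge_boundary_def doubleton_eq_iff)
        have B: "{a, b} \<in> E \<and> f (insert {a, b} \<omega>) - f \<omega> = 1" if ab: "(a, b) \<in> ?B" for a b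
        proof
          have aK: "a \<notin> K \<omega>" "b \<in> K \<omega>" "{a, b} \<in> edges G"
            using ab by (auto simp: edge_boundary_def)
          then show "{a, b} \<in> E" using touch outside by blast
          let ?\<omega> = "insert {a, b} \<omega>"
          have "b \<in> K ?\<omega>"
            using aK(2) cluster_mono[of \<omega> ?\<omega> "- \<Lambda>" "- \<Lambda>"] unfolding K_def by blast
          then have "a \<in> K ?\<omega>"
            unfolding K_def by (rule cluster_step) (simp add: insert_commute)
          then have "cluster ?\<omega> {a} \<subseteq> K ?\<omega>"
            unfolding K_def by (intro cluster_trans) auto
          moreover have "u \<in> cluster ?\<omega> {a}"
            using ab cluster_sym[of a ?\<eta> u] cluster_mono[of ?\<eta> ?\<omega> "{a}" "{a}"] by blast
          ultimately show "f ?\<omega> - f \<omega> = 1" using False by (auto simp: f_def)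
        qed
        have "F (K \<omega>) ?\<eta> = card ?B" using False by (simp add: F_def)
        also have "\<dots> = (\<Sum>b\<in>?B. 1)" by simp
        also have "\<dots> = (\<Sum>b\<in>?B. f (insert (case b of (a, b) \<Rightarrow> {a, b}) \<omega>) - f \<omega>)"
          using B by (intro sum.cong) auto
        also have "\<dots> = (\<Sum>e\<in>(\<lambda>(a, b). {a, b}) ` ?B. f (insert e \<omega>) - f \<omega>)"
          by (subst sum.reindex[OF inj]) simp
        also have "\<dots> \<le> (\<Sum>e\<in>E. f (insert e \<omega>) - f \<omega>)"
          using E(1) B mono by (intro sum_mono2) auto
        finally show ?thesis .
      qed
    qed
    also have "\<dots> \<le> ?D x"
      using E x01 mono by (intro bexp_derivative_ge) auto
    finally show ?thesis .
  qed
  obtain x where x: "p < x" "x < q" and mvt: "bexp E q f - bexp E p f = (q - p) * ?D x"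
    using MVT2[OF p(2), of "\<lambda>x. bexp E x f" ?D] bexp_has_derivative[OF E(1)] by blast
  have "bexp E x f \<le> bexp E q f"
    using x p mono by (intro bexp_mono_prob E) auto
  then have "(q - p) * (1 - bexp E q f) \<le> (q - p) * ?D x"
    using deriv[OF x] p by (intro mult_left_mono) auto
  also have "\<dots> \<le> bexp E q f"
    using mvt bexp_nonneg[of p E f] p by (simp add: f_def)
  finally have "(q - p) / (1 + (q - p)) \<le> bexp E q f"
    using p by (simp add: field_simps)
  also have "\<dots> \<le> bexp E q (\<lambda>\<omega>. of_bool (N \<le> card (cluster \<omega> {u})))"
  proof (rule bexp_mono)
    fix \<omega> assume \<omega>: "\<omega> \<subseteq> E"
    have fin: "finite (cluster \<omega> {u})"
      using \<omega> E finite_subset by (intro finite_open_cluster) auto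
    have "N \<le> card (cluster \<omega> {u})" if u': "u \<in> K \<omega>"
    proof -
      obtain v where v: "v \<notin> \<Lambda>" "u \<in> cluster \<omega> {v}"
        using u' by (auto simp: K_def cluster_def)
      then have "\<not> cluster \<omega> {u} \<subseteq> nbhd G N {u}"
        using cluster_sym[OF v(2)] by (auto simp: \<Lambda>_def)
      then have "N < card (cluster \<omega> {u} \<inter> nbhd G N {u})"
        using cluster_layers[of \<omega> u N] \<omega> E fin by auto
      also have "\<dots> \<le> card (cluster \<omega> {u})" using fin by (intro card_mono) auto
      finally show ?thesis by simp
    qed
    then show "f \<omega> \<le> of_bool (N \<le> card (cluster \<omega> {u}))" by (auto simp: f_def)
  qed (use p in auto)
  also have "\<dots> = tailp G q N u"
    unfolding E_def by (intro tailp_eq finite_ball_edges edges_inside_mono nbhd_mono) (auto simp: edges_inside_def)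
  finally show ?thesis .
qed

end

section \<open>Isomorphism invariance and the critical probability\<close>

lemma verts_induced_nbhd:
  assumes "lf_graph G" "v \<in> verts G"
  shows "verts (induced G (gball G v R)) = nbhd G R {v}"
  using assms lf_graph.gball_eq_nbhd[of G v R] lf_graph.nbhd_verts[of G "{v}" R]
  by (auto simp: induced_def)

text \<open>
  Serves both local convergence and, with two copies of one graph, the homogeneity of transitive graphs.
\<close>

lemma tailp_rooted_isomorphic:
  assumes G: "lf_graph G" and H: "lf_graph H" and v: "v \<in> verts G" and w: "w \<in> verts H"
    and iso: "rooted_isomorphic (induced G (gball G v R)) v (induced H (gball H w R)) w"
    and N: "N \<le> R"
  shows "tailp G p N v = tailp H p N w"
proof -
  interpret G: lf_graph G by (rule G)
  interpret H: lf_graph H by (rule H)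
  let ?V = "nbhd G R {v}" and ?W = "nbhd H R {w}"
  obtain f where f: "graph_iso f (induced G (gball G v R)) (induced H (gball H w R))" and fv: "f v = w"
    using iso by (auto simp: rooted_isomorphic_def)
  have bij: "bij_betw f ?V ?W"
    using f verts_induced_nbhd[OF G v] verts_induced_nbhd[OF H w] by (simp add: graph_iso_def)
  then have inj: "inj_on f ?V" by (rule bij_betw_imp_inj_on)
  have edge: "{x, y} \<in> edges G \<longleftrightarrow> {f x, f y} \<in> edges H" if "x \<in> ?V" "y \<in> ?V" for x y
  proof -
    have "(x, y) \<in> adj (induced G (gball G v R)) \<longleftrightarrow> (f x, f y) \<in> adj (induced H (gball H w R))"
      using f that verts_induced_nbhd[OF G v] by (auto simp: graph_iso_def)
    moreover have "f x \<in> ?W" "f y \<in> ?W" using bij that by (auto simp: bij_betw_def)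
    ultimately show ?thesis
      using that G.gball_eq_nbhd[OF v] H.gball_eq_nbhd[OF w] by (simp add: adj_def induced_def)
  qed
  let ?E = "edges_inside G ?V"
  have img: "edges_inside H ?W = (`) f ` ?E"
  proof
    show "edges_inside H ?W \<subseteq> (`) f ` ?E"
    proof
      fix e assume e: "e \<in> edges_inside H ?W"
      then obtain a b where ab: "e = {a, b}" by (auto simp: edges_inside_def elim: H.edgeE)
      then have "a \<in> f ` ?V" "b \<in> f ` ?V"
        using e bij by (auto simp: edges_inside_def bij_betw_def)
      then obtain x y where xy: "x \<in> ?V" "y \<in> ?V" "e = {f x, f y}" using ab by blast
      then have "{x, y} \<in> ?E" using e edge[of x y] by (simp add: edges_inside_def)
      moreover have "e = f ` {x, y}" using xy by simp
      ultimately show "e \<in> (`) f ` ?E" by blast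
    qed
    show "(`) f ` ?E \<subseteq> edges_inside H ?W"
    proof
      fix e' assume "e' \<in> (`) f ` ?E"
      then obtain e where e: "e \<in> ?E" "e' = f ` e" by blast
      then obtain x y where xy: "e = {x, y}" by (auto simp: edges_inside_def elim: G.edgeE)
      then have V: "x \<in> ?V" "y \<in> ?V" using e by (auto simp: edges_inside_def)
      then show "e' \<in> edges_inside H ?W"
        using e xy edge[OF V] bij by (auto simp: edges_inside_def bij_betw_def)
    qed
  qed
  have injE: "inj_on ((`) f) ?E"
    using inj_on_image_Pow[OF inj] by (rule inj_on_subset) (auto simp: edges_inside_def)
  have vV: "v \<in> ?V" using nbhd_self[of "{v}" G R] by simp
  have "tailp G p N v = bexp ?E p (\<lambda>\<omega>. of_bool (N \<le> card (cluster \<omega> {v})))"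
    by (rule G.tailp_eq[OF G.finite_ball_edges _ edges_inside_mono[OF nbhd_mono[OF N subset_refl]], symmetric])
      (simp add: edges_inside_def)
  also have "\<dots> = bexp ?E p (\<lambda>\<omega>. of_bool (N \<le> card (cluster ((`) f ` \<omega>) {w})))"
  proof (rule bexp_cong)
    fix \<omega> assume \<omega>: "\<omega> \<subseteq> ?E"
    then have "e \<subseteq> ?V" if "e \<in> \<omega>" for e using that by (auto simp: edges_inside_def)
    then have "cluster ((`) f ` \<omega>) (f ` {v}) = f ` cluster \<omega> {v}" "cluster \<omega> {v} \<subseteq> ?V"
      using cluster_image[OF inj, of \<omega> "{v}"] cluster_subset[of \<omega> "{v}"] vV by blast+
    then have "card (cluster ((`) f ` \<omega>) {w}) = card (cluster \<omega> {v})"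
      using card_image[OF inj_on_subset[OF inj]] fv by simp
    then show "of_bool (N \<le> card (cluster \<omega> {v})) = (of_bool (N \<le> card (cluster ((`) f ` \<omega>) {w})) :: real)"
      by simp
  qed
  also have "\<dots> = bexp ((`) f ` ?E) p (\<lambda>\<omega>. of_bool (N \<le> card (cluster \<omega> {w})))"
    by (rule bexp_image[symmetric, OF G.finite_ball_edges injE])
  also have "\<dots> = tailp H p N w"
    unfolding img[symmetric]
    by (rule H.tailp_eq[OF H.finite_ball_edges _ edges_inside_mono[OF nbhd_mono[OF N subset_refl]]])
      (simp add: edges_inside_def)
  finally show ?thesis .
qed

lemma card_ball_rooted_isomorphic:
  assumes "lf_graph G" "lf_graph H" "v \<in> verts G" "w \<in> verts H"
    and "rooted_isomorphic (induced G (gball G v R)) v (induced H (gball H w R)) w"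
  shows "card (nbhd G R {v}) = card (nbhd H R {w})"
  using assms(5) bij_betw_same_card
    verts_induced_nbhd[OF assms(1,3), of R] verts_induced_nbhd[OF assms(2,4), of R]
  by (auto simp: rooted_isomorphic_def graph_iso_def)

context lf_graph
begin

lemma automorphism_nbrs:
  assumes f: "graph_iso f G G" and x: "x \<in> verts G"
  shows "f ` nbrs G x = nbrs G (f x)"
proof
  have bij: "bij_betw f (verts G) (verts G)" using f by (simp add: graph_iso_def)
  have edge: "(a, b) \<in> adj G \<longleftrightarrow> (f a, f b) \<in> adj G" if "a \<in> verts G" "b \<in> verts G" for a b
    using f that by (simp add: graph_iso_def)
  show "f ` nbrs G x \<subseteq> nbrs G (f x)"
  proof
    fix z assume "z \<in> f ` nbrs G x"
    then obtain y where y: "y \<in> nbrs G x" "z = f y" by blast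
    then have "y \<in> verts G" by (auto simp: nbrs_iff dest: edge_verts)
    then show "z \<in> nbrs G (f x)" using y edge[OF x] by (simp add: nbrs_def)
  qed
  show "nbrs G (f x) \<subseteq> f ` nbrs G x"
  proof
    fix z assume z: "z \<in> nbrs G (f x)"
    then have "z \<in> verts G" by (auto simp: nbrs_iff dest: edge_verts)
    then obtain y where y: "y \<in> verts G" "z = f y" using bij by (auto simp: bij_betw_def)
    then show "z \<in> f ` nbrs G x" using z edge[OF x y(1)] by (auto simp: nbrs_def)
  qed
qed

lemma automorphism_nbhd:
  assumes f: "graph_iso f G G" and A: "A \<subseteq> verts G"
  shows "f ` nbhd G i A = nbhd G i (f ` A)"
proof (induction i)
  case (Suc i)
  have "f ` (\<Union>x\<in>nbhd G i A. nbrs G x) = (\<Union>x\<in>nbhd G i A. nbrs G (f x))"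
    using automorphism_nbrs[OF f] nbhd_verts[OF A, of i] by blast
  then show ?case using Suc by (simp add: image_Un) (metis UN_simps(10) image_UN)
qed simp

lemma transitive_homogeneous:
  assumes "transitive_graph G"
  shows "homogeneous_graph G"
proof
  fix v w p N assume v: "v \<in> verts G" and w: "w \<in> verts G"
  obtain f where f: "graph_iso f G G" "f v = w"
    using assms v w by (auto simp: transitive_graph_def)
  have bij: "bij_betw f (verts G) (verts G)" using f by (simp add: graph_iso_def)
  have img: "f ` nbhd G N {v} = nbhd G N {w}"
    using automorphism_nbhd[OF f(1), of "{v}" N] v f(2) by simp
  have sub: "nbhd G N {v} \<subseteq> verts G" using v by (intro nbhd_verts) auto
  have "graph_iso f (induced G (gball G v N)) (induced G (gball G w N))"
    unfolding graph_iso_def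
  proof (intro conjI ballI)
    have lfG: "lf_graph G" by (rule lf_graph_axioms)
    note V = verts_induced_nbhd[OF lfG v, of N] and W = verts_induced_nbhd[OF lfG w, of N]
    show "bij_betw f (verts (induced G (gball G v N))) (verts (induced G (gball G w N)))"
      unfolding V W using bij_betw_subset[OF bij sub] img by simp
    fix x y assume xy: "x \<in> verts (induced G (gball G v N))" "y \<in> verts (induced G (gball G v N))"
    then have xyV: "x \<in> nbhd G N {v}" "y \<in> nbhd G N {v}" unfolding V by auto
    then have "f x \<in> nbhd G N {w}" "f y \<in> nbhd G N {w}" using img by auto
    moreover have "(x, y) \<in> adj G \<longleftrightarrow> (f x, f y) \<in> adj G"
      using f xyV sub by (auto simp: graph_iso_def)
    ultimately show "(x, y) \<in> adj (induced G (gball G v N)) \<longleftrightarrow> (f x, f y) \<in> adj (induced G (gball G w N))"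
      using xyV gball_eq_nbhd[OF v] gball_eq_nbhd[OF w] by (simp add: adj_def induced_def)
  qed
  then have "rooted_isomorphic (induced G (gball G v N)) v (induced G (gball G w N)) w"
    using f(2) by (auto simp: rooted_isomorphic_def)
  then show "tailp G p N v = tailp G p N w"
    using tailp_rooted_isomorphic[OF lf_graph_axioms lf_graph_axioms v w] by blast
qed

end

text \<open>
  The finite expectations agree with the product measure on events that depend on finitely many edges.
\<close>

lemma percolation_cylinder:
  assumes p: "0 \<le> p" "p \<le> 1" and F: "finite F" "F \<subseteq> edges G"
  shows "{\<omega> \<in> space (percolation G p). Q {e \<in> F. \<omega> e}} \<in> sets (percolation G p)" (is ?meas)
    and "measure (percolation G p) {\<omega> \<in> space (percolation G p). Q {e \<in> F. \<omega> e}} =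
      bexp F p (\<lambda>S. of_bool (Q S))" (is ?val)
proof -
  let ?b = "\<lambda>_::'a set. measure_pmf (bernoulli_pmf p)"
  interpret product_prob_space ?b "edges G"
    by unfold_locales
  let ?M = "percolation G p"
  have M: "?M = PiM (edges G) ?b" by (simp add: percolation_def)
  have sp: "space ?M = PiE (edges G) (\<lambda>_. UNIV)" by (simp add: M space_PiM)
  let ?c = "\<lambda>S. {\<omega> \<in> space ?M. {e \<in> F. \<omega> e} = S}"
  have c: "?c S = prod_emb (edges G) ?b F (PiE F (\<lambda>e. {e \<in> S}))" if "S \<subseteq> F" for S
    using that F unfolding sp by (auto simp: prod_emb_def space_PiM PiE_iff restrict_def extensional_def)
  have c_sets: "?c S \<in> sets ?M" if "S \<subseteq> F" for S
    unfolding c[OF that] unfolding M using F by (intro sets_PiM_I) auto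
  have c_val: "measure ?M (?c S) = p ^ card S * (1 - p) ^ card (F - S)" if S: "S \<subseteq> F" for S
  proof -
    have "measure ?M (?c S) = (\<Prod>e\<in>F. measure (measure_pmf (bernoulli_pmf p)) {e \<in> S})"
      unfolding c[OF S] unfolding M using F by (intro measure_PiM_emb) auto
    also have "\<dots> = (\<Prod>e\<in>F. if e \<in> S then p else 1 - p)"
      using p by (intro prod.cong) (auto simp: measure_pmf_single)
    also have "\<dots> = p ^ card (F \<inter> S) * (1 - p) ^ card (F \<inter> - S)"
      using F by (simp add: prod.If_cases)
    also have "F \<inter> S = S" using S by auto
    also have "F \<inter> - S = F - S" by auto
    finally show ?thesis .
  qed
  have un: "{\<omega> \<in> space ?M. Q {e \<in> F. \<omega> e}} = (\<Union>S\<in>{S \<in> Pow F. Q S}. ?c S)" by auto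
  have fin: "finite {S \<in> Pow F. Q S}" using F by simp
  show ?meas unfolding un using fin c_sets by (intro sets.finite_UN) auto
  have "measure ?M (\<Union>S\<in>{S \<in> Pow F. Q S}. ?c S) = (\<Sum>S\<in>{S \<in> Pow F. Q S}. measure ?M (?c S))"
  proof (rule measure_finite_Union[OF fin])
    show "disjoint_family_on ?c {S \<in> Pow F. Q S}" by (auto simp: disjoint_family_on_def)
    show "emeasure ?M (?c S) \<noteq> \<infinity>" for S unfolding M using emeasure_eq_measure by simp
  qed (use c_sets in auto)
  also have "\<dots> = (\<Sum>S\<in>{S \<in> Pow F. Q S}. p ^ card S * (1 - p) ^ card (F - S))"
    using c_val by (intro sum.cong) auto
  also have "\<dots> = (\<Sum>S\<in>Pow F. p ^ card S * (1 - p) ^ card (F - S) * of_bool (Q S))"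
    using F by (intro sum.mono_neutral_cong_left) auto
  finally show ?val unfolding un bexp_def .
qed

context lf_graph
begin

lemma connected_covered:
  assumes "connected_graph G" "u \<in> verts G"
  shows "verts G \<subseteq> (\<Union>i. nbhd G i {u})"
proof
  fix x assume "x \<in> verts G"
  then have "(u, x) \<in> (adj G)\<^sup>*" using assms by (auto simp: connected_graph_def)
  then show "x \<in> (\<Union>i. nbhd G i {u})"
  proof (induction rule: rtrancl_induct)
    case base
    show ?case by (rule UN_I[of 0]) auto
  next
    case (step y z)
    then obtain i where "y \<in> nbhd G i {u}" by blast
    then have "z \<in> nbhd G (Suc i) {u}" using step by (intro nbhd_step) (auto simp: adj_def)
    then show ?case by blast
  qed
qed

lemma countable_verts:
  assumes "connected_graph G"
  shows "countable (verts G)"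
proof -
  obtain u where u: "u \<in> verts G" using assms by (auto simp: connected_graph_def)
  have "countable (\<Union>i. nbhd G i {u})"
    by (intro countable_UN) (auto intro: countable_finite finite_nbhd)
  then show ?thesis using connected_covered[OF assms u] countable_subset by blast
qed

text \<open>
  The events that the component has at least \<open>N\<close> vertices are cylinders and decrease to the event that it is
  infinite.
\<close>

lemma infinite_component_measure:
  assumes p: "0 \<le> p" "p \<le> 1" and v: "v \<in> verts G"
  defines "I \<equiv> {\<omega> \<in> space (percolation G p). infinite (component (open_subgraph G \<omega>) v)}"
  shows "I \<in> sets (percolation G p)" and "(\<lambda>N. tailp G p N v) \<longlonglongrightarrow> measure (percolation G p) I"
    and "measure (percolation G p) I \<le> tailp G p N v"
proof -
  let ?M = "percolation G p"
  interpret prob_space ?M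
    unfolding percolation_def by (intro prob_space_PiM) (simp add: prob_space_measure_pmf)
  define A where "A N = {\<omega> \<in> space ?M. N \<le> card (cluster {e \<in> edges_inside G (nbhd G N {v}). \<omega> e} {v})}" for N
  have sub: "edges_inside G (nbhd G N {v}) \<subseteq> edges G" for N by (auto simp: edges_inside_def)
  have A_sets: "A N \<in> sets ?M" for N
    unfolding A_def by (rule percolation_cylinder(1)[OF p finite_ball_edges sub])
  have A_val: "measure ?M (A N) = tailp G p N v" for N
    unfolding A_def tailp_def
    by (rule percolation_cylinder(2)[OF p finite_ball_edges sub])
  have comp: "component (open_subgraph G \<omega>) v = cluster {e \<in> edges G. \<omega> e} {v}" for \<omega>
    using cluster_subset[of "{e \<in> edges G. \<omega> e}" "{v}"] v
    by (auto simp: component_def cluster_def adj_def open_subgraph_def elim: edgeE)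
  have A_iff: "\<omega> \<in> A N \<longleftrightarrow> \<omega> \<in> space ?M \<and>
      (infinite (component (open_subgraph G \<omega>) v) \<or> N \<le> card (component (open_subgraph G \<omega>) v))" for \<omega> N
  proof -
    have eq: "{e \<in> edges_inside G (nbhd G N {v}). \<omega> e} = {e \<in> edges G. \<omega> e} \<inter> edges_inside G (nbhd G N {v})"
      by (auto simp: edges_inside_def)
    show ?thesis
      using large_cluster_local[of "{e \<in> edges G. \<omega> e}" v N] unfolding comp by (auto simp: A_def eq)
  qed
  have I: "I = (\<Inter>N. A N)"
  proof
    show "I \<subseteq> (\<Inter>N. A N)" by (auto simp: I_def A_iff)
    show "(\<Inter>N. A N) \<subseteq> I"
    proof
      fix \<omega> assume w: "\<omega> \<in> (\<Inter>N. A N)"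
      then have "\<omega> \<in> A (Suc (card (component (open_subgraph G \<omega>) v)))" by blast
      then show "\<omega> \<in> I" by (auto simp: A_iff I_def)
    qed
  qed
  show "I \<in> sets ?M" unfolding I using A_sets by (intro sets.countable_INT) auto
  have "decseq A" by (auto simp: decseq_def A_iff)
  then have "(\<lambda>N. measure ?M (A N)) \<longlonglongrightarrow> measure ?M (\<Inter>N. A N)"
    using A_sets by (intro finite_Lim_measure_decseq) auto
  then show "(\<lambda>N. tailp G p N v) \<longlonglongrightarrow> measure ?M I" by (simp add: A_val I)
  have "measure ?M I \<le> measure ?M (A N)"
    using A_sets by (intro finite_measure_mono) (auto simp: I)
  then show "measure ?M I \<le> tailp G p N v" by (simp add: A_val)
qed

end

context homogeneous_graph
begin

text \<open>
  There are countably many vertices, so an infinite component exists with positive probability only if some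
  vertex has one with positive probability; by homogeneity any vertex serves.
\<close>

lemma percolates_iff_tail:
  assumes p: "0 \<le> p" "p \<le> 1" and u: "u \<in> verts G" and conn: "connected_graph G"
  shows "0 < measure (percolation G p) {\<omega> \<in> space (percolation G p).
      \<exists>v\<in>verts G. infinite (component (open_subgraph G \<omega>) v)} \<longleftrightarrow>
    (\<exists>t>0. \<forall>N. t \<le> tailp G p N u)"
proof -
  let ?M = "percolation G p"
  interpret prob_space ?M
    unfolding percolation_def by (intro prob_space_PiM) (simp add: prob_space_measure_pmf)
  define I where "I v = {\<omega> \<in> space ?M. infinite (component (open_subgraph G \<omega>) v)}" for v
  let ?U = "{\<omega> \<in> space ?M. \<exists>v\<in>verts G. infinite (component (open_subgraph G \<omega>) v)}"
  have U: "?U = (\<Union>v\<in>verts G. I v)" by (auto simp: I_def)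
  have I_sets: "I v \<in> sets ?M" if "v \<in> verts G" for v
    unfolding I_def using infinite_component_measure(1)[OF p that] .
  have U_sets: "?U \<in> sets ?M"
    unfolding U using I_sets countable_verts[OF conn] by (intro sets.countable_UN') auto
  show ?thesis
  proof
    assume pos: "0 < measure ?M ?U"
    have "\<exists>v\<in>verts G. 0 < measure ?M (I v)"
    proof (rule ccontr)
      assume "\<not> ?thesis"
      then have "I v \<in> null_sets ?M" if "v \<in> verts G" for v
        using that I_sets measure_nonneg[of ?M "I v"]
        by (auto simp: null_sets_def emeasure_eq_measure not_less intro: antisym)
      then have "(\<Union>v\<in>verts G. I v) \<in> null_sets ?M"
        using countable_verts[OF conn] by (intro null_sets_UN') auto
      then show False using pos by (simp add: U measure_eq_0_null_sets)
    qed
    then obtain v where v: "v \<in> verts G" "0 < measure ?M (I v)" by blast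
    have "measure ?M (I v) \<le> tailp G p N u" for N
      using infinite_component_measure(3)[OF p v(1), of N] homogeneous[OF v(1) u] by (simp add: I_def)
    then show "\<exists>t>0. \<forall>N. t \<le> tailp G p N u" using v(2) by blast
  next
    assume "\<exists>t>0. \<forall>N. t \<le> tailp G p N u"
    then obtain t where t: "0 < t" "\<And>N. t \<le> tailp G p N u" by blast
    have "t \<le> measure ?M (I u)"
      using infinite_component_measure(2)[OF p u] t(2) unfolding I_def by (intro LIMSEQ_le_const) auto
    also have "\<dots> \<le> measure ?M ?U"
      using U_sets u by (intro finite_measure_mono) (auto simp: I_def)
    finally show "0 < measure ?M ?U" using t by simp
  qed
qed

lemma p_c_tail:
  assumes u: "u \<in> verts G" and conn: "connected_graph G"
  shows "p_c G = Inf {p \<in> {0..1}. \<exists>t>0. \<forall>N. t \<le> tailp G p N u}"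
proof -
  have "{p \<in> {0..1}. 0 < measure (percolation G p) {\<omega> \<in> space (percolation G p).
      \<exists>v\<in>verts G. infinite (component (open_subgraph G \<omega>) v)}} =
    {p \<in> {0..1}. \<exists>t>0. \<forall>N. t \<le> tailp G p N u}"
    using percolates_iff_tail[OF _ _ u conn] by auto
  then show ?thesis by (simp add: p_c_def)
qed

lemma tailp_1:
  assumes u: "u \<in> verts G" and conn: "connected_graph G" and inf: "infinite (verts G)"
  shows "tailp G 1 N u = 1"
proof -
  have one: "bexp E 1 f = f E" if "finite E" for E :: "'a set set" and f
    using that by (induction E arbitrary: f rule: finite_induct) (auto simp: bexp_insert)
  have "nbhd G i {u} \<subseteq> cluster (edges G) {u}" for i
    by (induction i) (auto simp: nbrs_iff intro: cluster_step)
  then have "verts G \<subseteq> cluster (edges G) {u}"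
    using connected_covered[OF conn u] by blast
  then have "infinite (cluster (edges G) {u})" using inf finite_subset by blast
  then have "N \<le> card (cluster (edges G \<inter> edges_inside G (nbhd G N {u})) {u})"
    using large_cluster_local[of "edges G" u N] by simp
  moreover have "edges G \<inter> edges_inside G (nbhd G N {u}) = edges_inside G (nbhd G N {u})"
    by (auto simp: edges_inside_def)
  ultimately show ?thesis by (simp add: tailp_def one finite_ball_edges)
qed

lemma p_c_facts:
  assumes u: "u \<in> verts G" and conn: "connected_graph G" and inf: "infinite (verts G)"
  shows p_c_nonneg: "0 \<le> p_c G" and p_c_le_1: "p_c G \<le> 1"
    and p_c_le: "\<lbrakk>0 \<le> p; p \<le> 1; 0 < t; \<And>N. t \<le> tailp G p N u\<rbrakk> \<Longrightarrow> p_c G \<le> p"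
    and above_p_c: "\<lbrakk>p_c G < p; p \<le> 1\<rbrakk> \<Longrightarrow> \<exists>t>0. \<forall>N. t \<le> tailp G p N u"
proof -
  let ?S = "{p \<in> {0..1}. \<exists>t>0. \<forall>N. t \<le> tailp G p N u}"
  note eq = p_c_tail[OF u conn]
  have one: "1 \<in> ?S" using tailp_1[OF assms] by (auto intro!: exI[of _ "1::real"])
  have bdd: "bdd_below ?S" by (rule bdd_belowI[of _ 0]) auto
  show "0 \<le> p_c G" unfolding eq using one by (intro cInf_greatest) auto
  show "p_c G \<le> 1" unfolding eq by (rule cInf_lower[OF one bdd])
  show "p_c G \<le> p" if "0 \<le> p" "p \<le> 1" "0 < t" "\<And>N. t \<le> tailp G p N u"
    unfolding eq using that by (intro cInf_lower[OF _ bdd]) auto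
  show "\<exists>t>0. \<forall>N. t \<le> tailp G p N u" if p: "p_c G < p" "p \<le> 1"
  proof -
    obtain q where q: "q \<in> ?S" "q < p"
      using p(1) one cInf_lessD[of ?S p] unfolding eq by blast
    then obtain t where t: "0 < t" "\<And>N. t \<le> tailp G q N u" by auto
    have "t \<le> tailp G p N u" for N
      using t(2)[of N] tailp_mono[of q p N u] q p by simp
    then show ?thesis using t(1) by blast
  qed
qed

end

section \<open>The spectral gap and vertex expansion\<close>

context lf_graph
begin

lemma deg_transition_op: "real (deg G x) * transition_op G f x = (\<Sum>y\<in>nbrs G x. f y)"
proof (cases "deg G x = 0")
  case True
  then have "nbrs G x = {}" using finite_nbrs by (simp add: deg_def)
  then show ?thesis using True by simp
next
  case False
  then show ?thesis by (simp add: transition_op_def sum_distrib_left)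
qed

text \<open>
  From \<open>2 f(x) f(y) \<le> f(x)\<^sup>2 + f(y)\<^sup>2\<close>, on a finite set \<open>F\<close> of vertices \<open>x\<close> the sum of the integrand
  \<open>g\<close> is at least half the difference between the sum of \<open>a\<close> over \<open>F\<close> and the sum of \<open>f(y)\<^sup>2\<close> over the
  edges \<open>(x, y)\<close> with \<open>x \<in> F\<close>. Grouped by \<open>y\<close>, the latter is at most the full sum of \<open>a\<close>, so the bound
  tends to \<open>0\<close> as \<open>F\<close> exhausts the graph. If the integrand is not summable, its infinite sum is \<open>0\<close> by
  convention.
\<close>

lemma dirichlet_form_nonneg:
  assumes f: "f \<in> l2_deg G"
  shows "0 \<le> inner_deg G f (\<lambda>x. f x - transition_op G f x)"
proof -
  define a where "a x = real (deg G x) * (f x)\<^sup>2" for x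
  define g where "g x = real (deg G x) * f x * (f x - transition_op G f x)" for x
  have a: "a summable_on verts G" using f by (simp add: l2_deg_def a_def[abs_def])
  have a0: "0 \<le> a x" for x by (simp add: a_def)
  have g_eq: "g x = a x - f x * (\<Sum>y\<in>nbrs G x. f y)" for x
    using deg_transition_op[of x f] by (simp add: g_def a_def power2_eq_square algebra_simps)
  have g_ge: "a x / 2 - (\<Sum>y\<in>nbrs G x. (f y)\<^sup>2) / 2 \<le> g x" for x
  proof -
    have "f x * (\<Sum>y\<in>nbrs G x. f y) = (\<Sum>y\<in>nbrs G x. f x * f y)"
      by (simp add: sum_distrib_left)
    also have "\<dots> \<le> (\<Sum>y\<in>nbrs G x. (f x)\<^sup>2 / 2 + (f y)\<^sup>2 / 2)"
    proof (rule sum_mono)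
      fix y
      show "f x * f y \<le> (f x)\<^sup>2 / 2 + (f y)\<^sup>2 / 2"
        using zero_le_power2[of "f x - f y"] by (simp add: power2_diff)
    qed
    also have "\<dots> = a x / 2 + (\<Sum>y\<in>nbrs G x. (f y)\<^sup>2) / 2"
      by (simp add: sum.distrib a_def deg_def sum_divide_distrib)
    finally show ?thesis by (simp add: g_eq)
  qed
  have lower: "- (infsum a (verts G) / 2) \<le> (\<Sum>x\<in>F. g x - a x / 2)"
    if F: "finite F" "F \<subseteq> verts G" for F
  proof -
    let ?F' = "\<Union>x\<in>F. nbrs G x"
    have F': "finite ?F'" "?F' \<subseteq> verts G"
      using F finite_nbrs by (auto simp: nbrs_iff dest: edge_verts)
    have "(\<Sum>x\<in>F. \<Sum>y\<in>nbrs G x. (f y)\<^sup>2) = (\<Sum>x\<in>F. \<Sum>y\<in>?F'. of_bool (y \<in> nbrs G x) * (f y)\<^sup>2)"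
      using F' by (intro sum.cong refl sum.mono_neutral_cong_left) auto
    also have "\<dots> = (\<Sum>y\<in>?F'. \<Sum>x\<in>F. of_bool (y \<in> nbrs G x) * (f y)\<^sup>2)"
      by (rule sum.swap)
    also have "\<dots> \<le> (\<Sum>y\<in>?F'. a y)"
    proof (rule sum_mono)
      fix y
      have "(\<Sum>x\<in>F. of_bool (y \<in> nbrs G x) * (f y)\<^sup>2) = card {x \<in> F. y \<in> nbrs G x} * (f y)\<^sup>2"
        using F(1) by (simp add: sum_distrib_right[symmetric] of_bool_def sum.If_cases Int_def)
      also have "\<dots> \<le> deg G y * (f y)\<^sup>2"
        unfolding deg_def using finite_nbrs
        by (intro mult_right_mono of_nat_mono card_mono) (auto simp: nbrs_iff insert_commute)
      finally show "(\<Sum>x\<in>F. of_bool (y \<in> nbrs G x) * (f y)\<^sup>2) \<le> a y" by (simp add: a_def)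
    qed
    also have "\<dots> \<le> infsum a (verts G)"
      using a F' a0 by (intro finite_sum_le_infsum) auto
    finally have "(\<Sum>x\<in>F. \<Sum>y\<in>nbrs G x. (f y)\<^sup>2) \<le> infsum a (verts G)" .
    moreover have "(\<Sum>x\<in>F. - (\<Sum>y\<in>nbrs G x. (f y)\<^sup>2) / 2) \<le> (\<Sum>x\<in>F. g x - a x / 2)"
    proof (rule sum_mono)
      fix x
      show "- (\<Sum>y\<in>nbrs G x. (f y)\<^sup>2) / 2 \<le> g x - a x / 2" using g_ge[of x] by linarith
    qed
    ultimately show ?thesis
      by (simp add: sum_negf sum_divide_distrib[symmetric])
  qed
  show ?thesis
  proof (cases "g summable_on verts G")
    case False
    then show ?thesis by (simp add: inner_deg_def g_def[abs_def] infsum_not_exists)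
  next
    case True
    have "((\<lambda>x. g x + - (1 / 2) * a x) has_sum (infsum g (verts G) + - (1 / 2) * infsum a (verts G))) (verts G)"
      using True a by (intro has_sum_add has_sum_cmult_right has_sum_infsum)
    then have "(sum (\<lambda>x. g x + - (1 / 2) * a x) \<longlongrightarrow> infsum g (verts G) + - (1 / 2) * infsum a (verts G))
        (finite_subsets_at_top (verts G))"
      by (simp only: has_sum_def)
    then have "- (infsum a (verts G) / 2) \<le> infsum g (verts G) + - (1 / 2) * infsum a (verts G)"
    proof (rule tendsto_lowerbound)
      show "\<forall>\<^sub>F F in finite_subsets_at_top (verts G).
          - (infsum a (verts G) / 2) \<le> sum (\<lambda>x. g x + - (1 / 2) * a x) F"
        using lower by (intro eventually_finite_subsets_at_top_weakI) auto
    qed simp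
    then show ?thesis by (simp add: inner_deg_def g_def[abs_def])
  qed
qed

lemma indicator_forms:
  assumes k: "finite k" "k \<subseteq> verts G"
  defines "f \<equiv> \<lambda>x. of_bool (x \<in> k) :: real"
  shows "f \<in> l2_deg G" and "inner_deg G f f = (\<Sum>x\<in>k. real (deg G x))"
    and "inner_deg G f (\<lambda>x. f x - transition_op G f x) = (\<Sum>x\<in>k. real (card (nbrs G x - k)))"
proof -
  have fin: "h summable_on verts G" "infsum h (verts G) = sum h k" if "\<And>x. x \<notin> k \<Longrightarrow> h x = 0" for h :: "'a \<Rightarrow> real"
  proof -
    have "h summable_on k" using k by simp
    then show "h summable_on verts G"
      using summable_on_cong_neutral[of "verts G" k h h] that k by auto
    have "infsum h (verts G) = infsum h k"
      using that k by (intro infsum_cong_neutral) auto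
    then show "infsum h (verts G) = sum h k" using k by simp
  qed
  show "f \<in> l2_deg G" unfolding l2_deg_def using fin(1) by (simp add: f_def)
  have "inner_deg G f f = (\<Sum>x\<in>k. real (deg G x) * f x * f x)"
    unfolding inner_deg_def by (rule fin(2)) (simp add: f_def)
  then show "inner_deg G f f = (\<Sum>x\<in>k. real (deg G x))" by (simp add: f_def)
  have "inner_deg G f (\<lambda>x. f x - transition_op G f x) =
      (\<Sum>x\<in>k. real (deg G x) * f x * (f x - transition_op G f x))"
    unfolding inner_deg_def by (rule fin(2)) (simp add: f_def)
  also have "\<dots> = (\<Sum>x\<in>k. real (card (nbrs G x - k)))"
  proof (rule sum.cong[OF refl])
    fix x assume x: "x \<in> k"
    have "real (deg G x) * f x * (f x - transition_op G f x) = real (deg G x) - (\<Sum>y\<in>nbrs G x. f y)"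
      using deg_transition_op[of x f] x by (simp add: f_def algebra_simps)
    also have "(\<Sum>y\<in>nbrs G x. f y) = card (nbrs G x \<inter> k)"
      using finite_nbrs by (simp add: f_def of_bool_def sum.If_cases)
    also have "real (deg G x) - card (nbrs G x \<inter> k) = card (nbrs G x - k)"
      using card_Int_Diff[OF finite_nbrs, of x k] by (simp add: deg_def)
    finally show "real (deg G x) * f x * (f x - transition_op G f x) = real (card (nbrs G x - k))" .
  qed
  finally show "inner_deg G f (\<lambda>x. f x - transition_op G f x) = (\<Sum>x\<in>k. real (card (nbrs G x - k)))" .
qed

text \<open>
  The constants \<open>l\<close> in the definition of \<open>lambda1\<close> include \<open>0\<close>, are bounded by \<open>1\<close> (test with the indicator of a
  vertex), and form a closed set. So the greatest one exists and has the defining property.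
\<close>

lemma lambda1_spectral_gap:
  assumes u: "u \<in> verts G" "0 < deg G u"
  shows "0 \<le> lambda1 G"
    and "f \<in> l2_deg G \<Longrightarrow> lambda1 G * inner_deg G f f \<le> inner_deg G f (\<lambda>x. f x - transition_op G f x)"
proof -
  define P where "P l \<longleftrightarrow> (\<forall>f\<in>l2_deg G.
     inner_deg G f (\<lambda>x. f x - transition_op G f x) \<ge> l * inner_deg G f f)" for l
  have P0: "P 0" using dirichlet_form_nonneg by (simp add: P_def)
  have le1: "l \<le> 1" if "P l" for l
  proof -
    have "nbrs G u - {u} = nbrs G u" using edge_verts[of u u] by (auto simp: nbrs_iff)
    then have "l * real (deg G u) \<le> real (deg G u)"
      using that indicator_forms[of "{u}"] u by (fastforce simp: P_def deg_def)
    then show ?thesis using u(2) by simp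
  qed
  define s where "s = Sup {l. P l}"
  have bdd: "bdd_above {l. P l}" using le1 by (intro bdd_aboveI) auto
  have s_ge: "l \<le> s" if "P l" for l unfolding s_def using that bdd by (intro cSup_upper) auto
  have "P s"
    unfolding P_def
  proof
    fix f assume f: "f \<in> l2_deg G"
    let ?N = "inner_deg G f f" and ?Q = "inner_deg G f (\<lambda>x. f x - transition_op G f x)"
    have N0: "0 \<le> ?N"
      unfolding inner_deg_def by (intro infsum_nonneg) (simp add: mult.assoc)
    show "s * ?N \<le> ?Q"
    proof (cases "?N = 0")
      case True
      then show ?thesis using dirichlet_form_nonneg[OF f] by simp
    next
      case False
      then have "l \<le> ?Q / ?N" if "P l" for l
        using that f N0 by (simp add: P_def pos_le_divide_eq)
      then have "s \<le> ?Q / ?N" unfolding s_def using P0 by (intro cSup_least) auto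
      then show ?thesis using False N0 by (simp add: pos_le_divide_eq)
    qed
  qed
  then have "lambda1 G = s"
    unfolding lambda1_def P_def[symmetric] using s_ge by (intro Greatest_equality) auto
  then show "0 \<le> lambda1 G" "f \<in> l2_deg G \<Longrightarrow>
      lambda1 G * inner_deg G f f \<le> inner_deg G f (\<lambda>x. f x - transition_op G f x)"
    using s_ge[OF P0] \<open>P s\<close> by (auto simp: P_def)
qed

lemma transitive_regular:
  assumes "transitive_graph G" "x \<in> verts G" "y \<in> verts G"
  shows "deg G x = deg G y"
proof -
  obtain f where f: "graph_iso f G G" "f x = y"
    using assms by (auto simp: transitive_graph_def)
  have "nbrs G x \<subseteq> verts G" by (auto simp: nbrs_iff dest: edge_verts)
  then have "inj_on f (nbrs G x)"
    using f(1) by (auto simp: graph_iso_def bij_betw_def intro: inj_on_subset)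
  then show ?thesis
    using automorphism_nbrs[OF f(1) assms(2)] f(2) card_image by (force simp: deg_def)
qed

lemma degree_pos:
  assumes conn: "connected_graph G" and inf: "infinite (verts G)" and u: "u \<in> verts G"
  shows "0 < deg G u"
proof (rule ccontr)
  assume "\<not> ?thesis"
  then have "nbrs G u = {}" using finite_nbrs by (simp add: deg_def)
  then have "nbhd G i {u} = {u}" for i by (induction i) auto
  then have "verts G \<subseteq> {u}" using connected_covered[OF conn u] by auto
  then show False using inf finite_subset by blast
qed

text \<open>
  Testing the spectral gap with the indicator of \<open>k\<close> bounds the number of boundary edges from below; in a
  regular graph each outer vertex absorbs at most as many of them as the degree.
\<close>

lemma transitive_vertex_expansion:
  assumes tr: "transitive_graph G" and conn: "connected_graph G" and inf: "infinite (verts G)"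
    and k: "finite k" "k \<subseteq> verts G"
  shows "(1 + lambda1 G) * card k \<le> card (nbhd G 1 k)"
proof -
  obtain u where u: "u \<in> verts G" using conn by (auto simp: connected_graph_def)
  have D: "0 < deg G u" by (rule degree_pos[OF conn inf u])
  have reg: "deg G x = deg G u" if "x \<in> verts G" for x by (rule transitive_regular[OF tr that u])
  let ?Z = "nbhd G 1 k - k"
  have finZ: "finite ?Z" using finite_nbhd[OF k(1), of 1] by blast
  have ZV: "?Z \<subseteq> verts G" using nbhd_verts[OF k(2), of 1] by blast
  have "lambda1 G * (\<Sum>x\<in>k. real (deg G x)) \<le> (\<Sum>x\<in>k. real (card (nbrs G x - k)))"
    using lambda1_spectral_gap(2)[OF u D indicator_forms(1)[OF k]] indicator_forms(2,3)[OF k] by simp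
  moreover have "(\<Sum>x\<in>k. real (deg G x)) = card k * real (deg G u)"
    using reg k by (simp add: subset_iff)
  ultimately have low: "lambda1 G * card k * deg G u \<le> (\<Sum>x\<in>k. real (card (nbrs G x - k)))"
    by (simp add: mult.assoc)
  have "(\<Sum>x\<in>k. real (card (nbrs G x - k))) = (\<Sum>x\<in>k. \<Sum>z\<in>?Z. of_bool (z \<in> nbrs G x))"
  proof (rule sum.cong[OF refl])
    fix x assume "x \<in> k"
    then have "nbrs G x - k = {z \<in> ?Z. z \<in> nbrs G x}" by auto
    then show "real (card (nbrs G x - k)) = (\<Sum>z\<in>?Z. of_bool (z \<in> nbrs G x))"
      using finZ by (simp add: of_bool_def sum.If_cases Int_def)
  qed
  also have "\<dots> = (\<Sum>z\<in>?Z. \<Sum>x\<in>k. of_bool (z \<in> nbrs G x))" by (rule sum.swap)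
  also have "\<dots> \<le> (\<Sum>z\<in>?Z. real (deg G u))"
  proof (rule sum_mono)
    fix z assume z: "z \<in> ?Z"
    have "(\<Sum>x\<in>k. of_bool (z \<in> nbrs G x) :: real) = card {x \<in> k. z \<in> nbrs G x}"
      using k by (simp add: of_bool_def sum.If_cases Int_def)
    also have "\<dots> \<le> card (nbrs G z)"
      using finite_nbrs by (intro of_nat_mono card_mono) (auto simp: nbrs_iff insert_commute)
    also have "\<dots> = deg G u" using reg z ZV by (auto simp: deg_def)
    finally show "(\<Sum>x\<in>k. of_bool (z \<in> nbrs G x)) \<le> real (deg G u)" .
  qed
  also have "\<dots> = card ?Z * deg G u" by simp
  finally have "lambda1 G * card k * deg G u \<le> card ?Z * real (deg G u)" using low by simp
  then have "lambda1 G * card k \<le> card ?Z" using D by simp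
  moreover have "card (nbhd G 1 k) = card ?Z + card k"
    using card_Diff_subset[OF k(1) nbhd_self[of k G 1]]
      card_mono[OF finite_nbhd[OF k(1)] nbhd_self[of k G 1]] by simp
  ultimately show ?thesis by (simp add: distrib_right)
qed

end

section \<open>Locality of the critical probability\<close>

text \<open>
  Only the scale \<open>A^m\<close>, at which the criterion is started, and the degree have to be read off from \<open>G\<close>. The
  parameter \<open>p\<close> lies strictly between \<open>p_c G\<close> and \<open>q\<close>, so \<open>G\<close> percolates at \<open>p\<close> and there remains room to
  sprinkle.
\<close>

lemma p_c_upper_semicontinuous:
  fixes Gs :: "nat \<Rightarrow> 'a ugraph" and G :: "'b ugraph"
  assumes G: "homogeneous_graph G" "infinite (verts G)" "connected_graph G"
    and Gs: "\<And>n. n \<ge> 1 \<Longrightarrow> simple_graph (Gs n)" "\<And>n. n \<ge> 1 \<Longrightarrow> transitive_graph (Gs n)"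
      "\<And>n. n \<ge> 1 \<Longrightarrow> infinite (verts (Gs n))" "\<And>n. n \<ge> 1 \<Longrightarrow> connected_graph (Gs n)"
      "\<And>n. n \<ge> 1 \<Longrightarrow> locally_finite_graph (Gs n)"
    and conv: "converges_locally Gs G"
    and lam: "0 < lam" "\<And>n. n \<ge> 1 \<Longrightarrow> lam \<le> lambda1 (Gs n)"
    and q: "p_c G < q"
  shows "\<forall>\<^sub>F n in sequentially. p_c (Gs n) \<le> q"
proof -
  interpret G: homogeneous_graph G by (rule G)
  obtain u where u: "u \<in> verts G" using G(3) by (auto simp: connected_graph_def)
  have homGs: "homogeneous_graph (Gs n)" if "n \<ge> 1" for n
    using that Gs by (intro lf_graph.transitive_homogeneous) (auto simp: lf_graph_def)
  show ?thesis
  proof (cases "q \<le> 1")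
    case False
    show ?thesis
    proof (rule eventually_sequentiallyI[of 1])
      fix n :: nat assume n: "1 \<le> n"
      obtain v where "v \<in> verts (Gs n)" using Gs(4)[OF n] by (auto simp: connected_graph_def)
      then have "p_c (Gs n) \<le> 1" by (rule homogeneous_graph.p_c_le_1[OF homGs[OF n] _ Gs(4)[OF n] Gs(3)[OF n]])
      then show "p_c (Gs n) \<le> q" using False by simp
    qed
  next
    case q1: True
    define p where "p = (p_c G + q) / 2"
    have p: "p_c G < p" "p < q" "0 < p" "p \<le> 1"
      using q q1 G.p_c_nonneg[OF u G(3,2)] by (auto simp: p_def)
    obtain t' where t': "0 < t'" "\<And>N. t' \<le> tailp G p N u"
      using G.above_p_c[OF u G(3,2) p(1) p(4)] by blast
    define t where "t = t' / 2"
    have t: "0 < t" "2 * t \<le> tailp G p N u" for N using t' by (auto simp: t_def)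
    define d where "d = card (nbhd G 1 {u})"
    define A where "A = nat \<lceil>real (1 + d) / p\<rceil>"
    have A: "(1 + d) / p \<le> A" unfolding A_def by (rule real_nat_ceiling_ge)
    have d: "1 \<le> d"
    proof -
      have "card {u} \<le> d" unfolding d_def by (intro card_mono G.finite_nbhd nbhd_self) auto
      then show ?thesis by simp
    qed
    have "2 \<le> real (1 + d) / p" using d p by (simp add: pos_le_divide_eq)
    then have A2: "2 \<le> A" using A by linarith
    obtain \<epsilon> m where s: "\<And>i. 0 < \<epsilon> i" "1 \<le> m" "\<And>j. sum \<epsilon> {m..<j} \<le> q - p"
      "\<And>j. (\<Sum>i = m..<j. real (2 * (A + 1)) / (\<epsilon> i * t * ((1 + lam) ^ i - 1))) \<le> t"
      using sprinkling_schedule[OF lam(1) t(1), of "q - p" "real (2 * (A + 1))"] p(2) by auto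
    obtain N where N: "1 \<le> N" "\<And>n v w. n \<ge> N \<Longrightarrow> v \<in> verts (Gs n) \<Longrightarrow> w \<in> verts G \<Longrightarrow>
        rooted_isomorphic (induced (Gs n) (gball (Gs n) v (A ^ m))) v (induced G (gball G w (A ^ m))) w"
      using conv unfolding converges_locally_def by meson
    obtain N' where N': "1 \<le> N'" "\<And>n v w. n \<ge> N' \<Longrightarrow> v \<in> verts (Gs n) \<Longrightarrow> w \<in> verts G \<Longrightarrow>
        rooted_isomorphic (induced (Gs n) (gball (Gs n) v 1)) v (induced G (gball G w 1)) w"
      using conv unfolding converges_locally_def by meson
    show ?thesis
    proof (rule eventually_sequentiallyI[of "max N N'"])
      fix n assume "max N N' \<le> n"
      then have n: "N \<le> n" "N' \<le> n" "1 \<le> n" using N by auto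
      obtain v where v: "v \<in> verts (Gs n)" using Gs(4)[OF n(3)] by (auto simp: connected_graph_def)
      interpret H: homogeneous_graph "Gs n" by (rule homGs[OF n(3)])
      note lfs = H.lf_graph_axioms G.lf_graph_axioms
      interpret H: expander "Gs n" d lam
      proof
        fix x assume x: "x \<in> verts (Gs n)"
        have "card (nbrs (Gs n) x) \<le> card (nbhd (Gs n) 1 {x})"
          using H.finite_nbrs by (intro card_mono) auto
        also have "\<dots> = d" unfolding d_def
          by (rule card_ball_rooted_isomorphic[OF lfs x u N'(2)[OF n(2) x u]])
        finally show "card (nbrs (Gs n) x) \<le> d" .
      next
        fix k assume k: "finite k" "k \<subseteq> verts (Gs n)"
        have "(1 + lam) * card k \<le> (1 + lambda1 (Gs n)) * card k"
          using lam(2)[OF n(3)] by (intro mult_right_mono) auto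
        also have "\<dots> \<le> card (nbhd (Gs n) 1 k)"
          using n by (intro H.transitive_vertex_expansion Gs k)
        finally show "(1 + lam) * card k \<le> card (nbhd (Gs n) 1 k)" .
      qed (rule lam(1))
      have "2 * t \<le> tailp (Gs n) p (A ^ m) v"
        using tailp_rooted_isomorphic[OF lfs v u N(2)[OF n(1) v u] order_refl, of p] t(2) by simp
      then have scales: "t \<le> tailp (Gs n) q (A ^ j) v" if "m \<le> j" for j
        using H.tail_all_scales[of p q A v m \<epsilon> t j] p q1 A v s t(1) that by simp
      have "t \<le> tailp (Gs n) q M v" for M
      proof -
        have "M \<le> max m M" by simp
        also have "\<dots> \<le> 2 ^ max m M" by (rule less_imp_le[OF less_exp])
        also have "\<dots> \<le> A ^ max m M" using A2 by (intro power_mono) auto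
        finally have "tailp (Gs n) q (A ^ max m M) v \<le> tailp (Gs n) q M v"
          using p q1 by (intro H.tailp_antimono) auto
        then show ?thesis using scales[of "max m M"] by simp
      qed
      then show "p_c (Gs n) \<le> q"
        using H.p_c_le[OF v Gs(4)[OF n(3)] Gs(3)[OF n(3)], of q t] p q1 t(1) by simp
    qed
  qed
qed

text \<open>
  If \<open>Gs n\<close> percolates at \<open>p\<close>, the mean-field bound holds at \<open>q\<close> for every size \<open>M\<close>; but \<open>q\<close> is below \<open>p_c G\<close>,
  so for some \<open>M\<close> it fails in \<open>G\<close>, and hence in any graph that agrees with \<open>G\<close> up to radius \<open>M\<close>.
\<close>

lemma p_c_lower_semicontinuous:
  fixes Gs :: "nat \<Rightarrow> 'a ugraph" and G :: "'b ugraph"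
  assumes G: "homogeneous_graph G" "infinite (verts G)" "connected_graph G"
    and Gs: "\<And>n. n \<ge> 1 \<Longrightarrow> homogeneous_graph (Gs n)"
      "\<And>n. n \<ge> 1 \<Longrightarrow> infinite (verts (Gs n))" "\<And>n. n \<ge> 1 \<Longrightarrow> connected_graph (Gs n)"
    and conv: "converges_locally Gs G"
    and p: "p < p_c G"
  shows "\<forall>\<^sub>F n in sequentially. p \<le> p_c (Gs n)"
proof -
  interpret G: homogeneous_graph G by (rule G)
  obtain u where u: "u \<in> verts G" using G(3) by (auto simp: connected_graph_def)
  define q where "q = (p + p_c G) / 2"
  have q: "p < q" "q < p_c G" "q \<le> 1"
    using p G.p_c_le_1[OF u G(3,2)] by (auto simp: q_def)
  define c where "c = (q - p) / (1 + (q - p))"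
  have c: "0 < c" using q by (simp add: c_def)
  show ?thesis
  proof (cases "0 \<le> p")
    case p0: True
    have "\<not> (\<forall>M. c \<le> tailp G q M u)"
      using G.p_c_le[OF u G(3,2) _ q(3) c] q p0 by force
    then obtain M where M: "tailp G q M u < c" by (auto simp: not_le)
    obtain N where N: "1 \<le> N" "\<And>n v w. n \<ge> N \<Longrightarrow> v \<in> verts (Gs n) \<Longrightarrow> w \<in> verts G \<Longrightarrow>
        rooted_isomorphic (induced (Gs n) (gball (Gs n) v M)) v (induced G (gball G w M)) w"
      using conv unfolding converges_locally_def by meson
    show ?thesis
    proof (rule eventually_sequentiallyI[of N])
      fix n assume n: "N \<le> n"
      then have n1: "1 \<le> n" using N by simp
      interpret H: homogeneous_graph "Gs n" by (rule Gs(1)[OF n1])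
      obtain v where v: "v \<in> verts (Gs n)" using Gs(3)[OF n1] by (auto simp: connected_graph_def)
      show "p \<le> p_c (Gs n)"
      proof (rule ccontr)
        assume "\<not> p \<le> p_c (Gs n)"
        then have less: "p_c (Gs n) < p" by simp
        then have "0 < p" using H.p_c_nonneg[OF v Gs(3)[OF n1] Gs(2)[OF n1]] by simp
        obtain t where t: "0 < t" "\<And>M. t \<le> tailp (Gs n) p M v"
          using H.above_p_c[OF v Gs(3)[OF n1] Gs(2)[OF n1] less] q by auto
        have "c \<le> tailp (Gs n) q M v"
          unfolding c_def by (rule H.percolating_mean_field[OF \<open>0 < p\<close> q(1,3) v t])
        also have "\<dots> = tailp G q M u"
          by (rule tailp_rooted_isomorphic[OF H.lf_graph_axioms G.lf_graph_axioms v u N(2)[OF n v u] order_refl])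
        finally show False using M by simp
      qed
    qed
  next
    case False
    show ?thesis
    proof (rule eventually_sequentiallyI[of 1])
      fix n :: nat assume n: "1 \<le> n"
      obtain v where v: "v \<in> verts (Gs n)" using Gs(3)[OF n] by (auto simp: connected_graph_def)
      have "0 \<le> p_c (Gs n)" by (rule homogeneous_graph.p_c_nonneg[OF Gs(1)[OF n] v Gs(3)[OF n] Gs(2)[OF n]])
      then show "p \<le> p_c (Gs n)" using False by simp
    qed
  qed
qed

theorem theorem1p5:
  fixes Gs :: "nat \<Rightarrow> 'a ugraph" and G :: "'b ugraph" and u :: 'b
  assumes "\<And>n. n \<ge> 1 \<Longrightarrow> simple_graph (Gs n)"
    and "\<And>n. n \<ge> 1 \<Longrightarrow> transitive_graph (Gs n)"
    and "\<And>n. n \<ge> 1 \<Longrightarrow> infinite (verts (Gs n))"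
    and "\<And>n. n \<ge> 1 \<Longrightarrow> connected_graph (Gs n)"
    and "\<And>n. n \<ge> 1 \<Longrightarrow> locally_finite_graph (Gs n)"
    and "uniformly_nonamenable Gs"
    and "simple_graph G"
    and "transitive_graph G"
    and "infinite (verts G)"
    and "connected_graph G"
    and "locally_finite_graph G"
    and "converges_locally Gs G"
    and "u \<in> verts G"
    and "\<exists>c C. 0 < c \<and> 0 < C \<and>
      (\<forall>n\<ge>1. \<forall>x\<in>gsphere G u n. \<forall>y\<in>gsphere G u n.
         c \<le> exit_prob G u n x / exit_prob G u n y \<and>
         exit_prob G u n x / exit_prob G u n y \<le> C)"
    and "\<forall>p. p_c G < p \<and> p < 1 \<longrightarrow> (\<exists>c1 c2. 0 < c1 \<and> 0 < c2 \<and>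
      (\<forall>n\<ge>1. \<forall>x\<in>gsphere G u n. \<forall>y\<in>gsphere G u n.
         c1 \<le> conn_in_ball G p u n x / conn_in_ball G p u n y \<and>
         conn_in_ball G p u n x / conn_in_ball G p u n y \<le> c2))"
  shows "(\<lambda>n. p_c (Gs n)) \<longlonglongrightarrow> p_c G"
proof (rule order_tendstoI)
  have lfG: "lf_graph G" and lfs: "\<And>n. n \<ge> 1 \<Longrightarrow> lf_graph (Gs n)"
    using assms(1,5,7,11) by (auto simp: lf_graph_def)
  have hom: "homogeneous_graph G" "\<And>n. n \<ge> 1 \<Longrightarrow> homogeneous_graph (Gs n)"
    using lf_graph.transitive_homogeneous[OF lfG assms(8)] lf_graph.transitive_homogeneous[OF lfs assms(2)] by auto
  define lam where "lam = (INF n\<in>{1..}. lambda1 (Gs n))"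
  have lam: "0 < lam" using assms(6) by (simp add: lam_def uniformly_nonamenable_def)
  have "0 \<le> lambda1 (Gs n)" if n: "n \<ge> 1" for n
  proof -
    obtain v where v: "v \<in> verts (Gs n)" using assms(4)[OF n] by (auto simp: connected_graph_def)
    then show ?thesis
      using lf_graph.lambda1_spectral_gap(1)[OF lfs[OF n] v] lf_graph.degree_pos[OF lfs[OF n] assms(4)[OF n] assms(3)[OF n] v]
      by blast
  qed
  then have bdd: "bdd_below ((\<lambda>n. lambda1 (Gs n)) ` {1..})" by (intro bdd_belowI2[of _ 0]) auto
  have le: "lam \<le> lambda1 (Gs n)" if "n \<ge> 1" for n
    unfolding lam_def using that bdd by (intro cINF_lower) auto
  fix a
  show "\<forall>\<^sub>F n in sequentially. a < p_c (Gs n)" if a: "a < p_c G"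
  proof -
    obtain b where b: "a < b" "b < p_c G" using dense[OF a] by blast
    have "\<forall>\<^sub>F n in sequentially. b \<le> p_c (Gs n)"
      by (rule p_c_lower_semicontinuous[OF hom(1) assms(9,10) hom(2) assms(3,4) assms(12) b(2)])
    then show ?thesis by eventually_elim (use b in simp)
  qed
  show "\<forall>\<^sub>F n in sequentially. p_c (Gs n) < a" if a: "p_c G < a"
  proof -
    obtain b where b: "p_c G < b" "b < a" using dense[OF a] by blast
    have "\<forall>\<^sub>F n in sequentially. p_c (Gs n) \<le> b"
      by (rule p_c_upper_semicontinuous[OF hom(1) assms(9,10) assms(1-5) assms(12) lam le b(1)])
    then show ?thesis by eventually_elim (use b in simp)
  qed
qed

end
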